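(* Let $0\to E_1\xrightarrow{\alpha}E_2\xrightarrow{\beta}E_3\to 0$ be an admissible triple of complete $C_1$-spaces over a finite field $\mathbb F_q$, $E_m=(I_m,F_m,V_m)$. Then for any $f\in\mathcal D(E_2)$, any $\mu_1\in\mu(E_1)$, $\mu_1\neq 0$, and any $\mu_2\in\mu(E_2)$, $\mu_2\ne 0$, the following equivalent statements hold: (1) $\displaystyle \int_{V_1}\alpha^*(f)\,d\mu_1=\int_{\check V_3}\check\beta^*(\mathbf F_{\mu_2}(f))\,d(\mu_1\otimes\mu_2^{-1})$; (2) $\mathbf F_{\mu_2^{-1}}(\delta_{E_1,\mu_1})=\delta_{\check E_3,\;\mu_1\otimes\mu_2^{-1}}$ in $\mathcal D'(\check E_2)$.
   Context: Fix a finite field $\mathbb F_q$ and a nontrivial character $\psi:\mathbb F_q\to\mathbb C^*$. All vector spaces below without specified field are over $\mathbb F_q$. A filtered vector space $(I,F,V)$ consists of a vector space $V$, a partially ordered set $I$ such that for all $i,j\in I$ there are $k,l\in I$ with $k\le i\le l$ and $k\le j\le l$, and a map $F$ from $I$ to subspaces of $V$ with $F(i)\subset F(j)$ for $i\le j$, $\bigcap_iF(i)=0$, $\bigcup_iF(i)=V$. It is a $C_1$-space if $F(j)/F(i)$ is finite-dimensional for all $i\le j$. It is complete if the natural map $V\to\varinjlim_i\varprojlim_{j\le i}F(i)/F(j)$ is an isomorphism. $(I_1,F_1,V)$ dominates $(I_2,F_2,V)$ if there is an order-preserving $\phi:I_2\to I_1$ with $F_1(\phi(i))=F_2(i)$ for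 all $i\in I_2$ and such that for every $j\in I_1$ there are $i_1,i_2\in I_2$ with $\phi(i_1)\le j\le\phi(i_2)$. An admissible triple $0\to E_1\xrightarrow{\alpha}E_2\xrightarrow{\beta}E_3\to0$ of $C_1$-spaces $E_m=(I_m,F_m,V_m)$ is an exact sequence of vector spaces such that (identifying $V_1$ with $\alpha(V_1)$) $(I_1,F_1,V_1)$ dominates $(I_2,F_1',V_1)$, $F_1'(i)=F_2(i)\cap V_1$, $(I_3,F_3,V_3)$ dominates $(I_2,F_3',V_3)$, $F_3'(i)=\beta(F_2(i))$, and for $i\le j$ in $I_2$ the induced sequences of the quotients $F_1'(j)/F_1'(i)$, $F_2(j)/F_2(i)$, $F_3'(j)/F_3'(i)$ are exact. Dual: for $E=(I,F,V)$ put $\check V=\bigcup_iF(i)^\perp\subset V^*$, where $F(i)^\perp$ is the annihilator; $\check E=(I^0,F^0,\check V)$, $I^0$ is $I$ with reversed order and $F^0(i)=F(i)^\perp$. An admissible triple induces an admissible triple $0\to\check E_3\xrightarrow{\check\beta}\check E_2\xrightarrow{\check\alpha}\check E_1\to 0$ with $\check\beta(u)=u\circ\beta$, $\check\alpha(u)=u\circ\alpha$. For complete $E$, $\check{\check E}=E$. $\mathcal D(E)$ is the space of functions $f:V\to\mathbb C$ for which there are $i\le j$ with $f=0$ outside $F(j)$ and $f$ invariant under translations by $F(i)$; $\mathcal D'(E)=\mathcal D(E)^*$. $\mu(E)\subset\mathcal D'(E)$ is the (one-dimensional) space of translation-invariant elements; for $\mu\in\mu(E)$ write $\int_Vf\,d\mu=\mu(f)$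 and $\mu(F(i))=\mu(\mathbf 1_{F(i)})$. For $0\ne\mu\in\mu(E)$ with $E$ complete, $\mu^{-1}\in\mu(\check E)$ is given by $\mu^{-1}(F(i)^\perp)=\mu(F(i))^{-1}$. There is a canonical isomorphism $\mu(E_1)\otimes\mu(E_3)\cong\mu(E_2)$, $(\mu_1\otimes\mu_3)(F_2(j))=\mu_1(F_2(j)\cap V_1)\,\mu_3(\beta(F_2(j)))$. For nonzero $\mu_1\in\mu(E_1)$, $\mu_2\in\mu(E_2)$ the element $\mu_1\otimes\mu_2^{-1}\in\mu(\check E_3)$ is $\mu_3^{-1}$, where $\mu_3\in\mu(E_3)$ is determined by $\mu_1\otimes\mu_3=\mu_2$. Fourier transform ($E$ complete): $\mathbf F_\mu:\mathcal D(E)\to\mathcal D(\check E)$, $\mathbf F_\mu(f)(w)=\int_Vf(v)\overline{\psi(w(v))}\,d\mu$. For $0\ne\mu\in\mu(E)$, $\mathbf F_{\mu^{-1}}:\mathcal D'(E)\to\mathcal D'(\check E)$ is $\mathbf F_{\mu^{-1}}(G)(f)=G(\mathbf F_{\mu^{-1}}(f))$, $f\in\mathcal D(\check E)$. $\alpha^*:\mathcal D(E_2)\to\mathcal D(E_1)$ is $f\mapsto f\circ\alpha$, and similarly $\check\beta^*:\mathcal D(\check E_2)\to\mathcal D(\check E_3)$. The characteristic functions are $\delta_{E_1,\mu_1}\in\mathcal D'(E_2)$, $\delta_{E_1,\mu_1}(f)=\int_{V_1}\alpha^*(f)\,d\mu_1$, and $\delta_{\check E_3,\nu}\in\mathcal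 D'(\check E_2)$, $\delta_{\check E_3,\nu}(g)=\int_{\check V_3}\check\beta^*(g)\,d\nu$ for $\nu\in\mu(\check E_3)$. *)

theory Defs
  imports Complex_Main
    "HOL-Library.Function_Algebras"
    "HOL-Library.Set_Algebras"
    "HOL-Library.Indicator_Function"
    "HOL-Library.FuncSet"
begin

section \<open>Filtered vector spaces\<close>

text \<open>
  The vector space is a subspace \<open>Vec\<close> of an ambient one, given by the additive group of the
  type \<open>'v\<close> and the scalar multiplication \<open>Scale\<close>; this way the dual, which is a space of
  functionals, is again an object of the same kind.  The order on \<open>Idx\<close> is a relation rather than
  a type class instance because the dual reverses it.
\<close>

record ('k, 'v, 'i) filtered =
  Idx :: "'i set"
  Ord :: "'i rel"
  Fil :: "'i \<Rightarrow> 'v set"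
  Vec :: "'v set"
  Scale :: "'k \<Rightarrow> 'v \<Rightarrow> 'v"

definition linear_on ::
  "('k \<Rightarrow> 'v \<Rightarrow> 'v) \<Rightarrow> ('k \<Rightarrow> 'w \<Rightarrow> 'w) \<Rightarrow> 'v set \<Rightarrow> ('v::plus \<Rightarrow> 'w::plus) \<Rightarrow> bool" where
  "linear_on s t V f \<longleftrightarrow>
     (\<forall>x\<in>V. \<forall>y\<in>V. f (x + y) = f x + f y) \<and> (\<forall>c. \<forall>x\<in>V. f (s c x) = t c (f x))"

definition filtered_space :: "('k::field, 'v::ab_group_add, 'i) filtered \<Rightarrow> bool" where
  "filtered_space E \<longleftrightarrow>
     vector_space (Scale E) \<and> module.subspace (Scale E) (Vec E) \<and>
     partial_order_on (Idx E) (Ord E) \<and>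
     (\<forall>i\<in>Idx E. \<forall>j\<in>Idx E. \<exists>k\<in>Idx E. \<exists>l\<in>Idx E.
        (k, i) \<in> Ord E \<and> (i, l) \<in> Ord E \<and> (k, j) \<in> Ord E \<and> (j, l) \<in> Ord E) \<and>
     (\<forall>i\<in>Idx E. module.subspace (Scale E) (Fil E i) \<and> Fil E i \<subseteq> Vec E) \<and>
     (\<forall>(i, j)\<in>Ord E. Fil E i \<subseteq> Fil E j) \<and>
     (\<Inter>i\<in>Idx E. Fil E i) = {0} \<and>
     (\<Union>i\<in>Idx E. Fil E i) = Vec E"

text \<open>
  Elements of the quotient \<open>A/B\<close> are cosets \<open>x +o B\<close>.  For a linear map \<open>f\<close> with
  \<open>f B \<subseteq> B'\<close>, the induced map \<open>A/B \<rightarrow> A'/B'\<close> takes a coset \<open>C\<close> to \<open>f ` C + B'\<close> (a sum of sets).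
\<close>

definition quot :: "'v::plus set \<Rightarrow> 'v set \<Rightarrow> 'v set set" where
  "quot A B = (\<lambda>x. x +o B) ` A"

definition quot_map :: "('v \<Rightarrow> 'w) \<Rightarrow> 'w::plus set \<Rightarrow> 'v set \<Rightarrow> 'w set" where
  "quot_map f B' C = f ` C + B'"

definition quot_finite_dim ::
  "('k::field \<Rightarrow> 'v::ab_group_add \<Rightarrow> 'v) \<Rightarrow> 'v set \<Rightarrow> 'v set \<Rightarrow> bool" where
  "quot_finite_dim s A B \<longleftrightarrow>
     (\<exists>S. finite S \<and> S \<subseteq> A \<and> (\<forall>C\<in>quot A B. \<exists>x\<in>module.span s S. C = x +o B))"

definition C1_space :: "('k::field, 'v::ab_group_add, 'i) filtered \<Rightarrow> bool" where
  "C1_space E \<longleftrightarrow>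
     filtered_space E \<and> (\<forall>(i, j)\<in>Ord E. quot_finite_dim (Scale E) (Fil E j) (Fil E i))"


section \<open>Completeness\<close>

definition below :: "('k, 'v, 'i) filtered \<Rightarrow> 'i \<Rightarrow> 'i set" where
  "below E i = {j. (j, i) \<in> Ord E}"

text \<open>The inverse limit of \<open>F(i)/F(j)\<close> over \<open>j \<le> i\<close>, as the set of compatible families.\<close>

definition inv_lim :: "('k, 'v::ab_group_add, 'i) filtered \<Rightarrow> 'i \<Rightarrow> ('i \<Rightarrow> 'v set) set" where
  "inv_lim E i =
     {c \<in> (\<Pi>\<^sub>E j\<in>below E i. quot (Fil E i) (Fil E j)).
        \<forall>j\<in>below E i. \<forall>k\<in>below E j. c j = quot_map id (Fil E j) (c k)}"

text \<open>
  The transition map from level \<open>i\<close> to level \<open>l\<close>, for \<open>i \<le> l\<close>.  Its component at \<open>j \<le> l\<close> is the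
  image of the component \<open>c k\<close> for any common lower bound \<open>k\<close> of \<open>i\<close> and \<open>j\<close>.  All such \<open>k\<close> give
  the same coset, so the union is over equal sets.
\<close>

definition lim_trans ::
  "('k, 'v::ab_group_add, 'i) filtered \<Rightarrow> 'i \<Rightarrow> 'i \<Rightarrow> ('i \<Rightarrow> 'v set) \<Rightarrow> ('i \<Rightarrow> 'v set)" where
  "lim_trans E i l c =
     (\<lambda>j\<in>below E l. \<Union>k\<in>below E i \<inter> below E j. quot_map id (Fil E j) (c k))"

definition colim_rel :: "('k, 'v::ab_group_add, 'i) filtered \<Rightarrow> ('i \<times> ('i \<Rightarrow> 'v set)) rel" where
  "colim_rel E =
     {((i, c), (i', c')) | i c i' c'.
        i \<in> Idx E \<and> i' \<in> Idx E \<and> c \<in> inv_lim E i \<and> c' \<in> inv_lim E i' \<and>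
        (\<exists>l. (i, l) \<in> Ord E \<and> (i', l) \<in> Ord E \<and> lim_trans E i l c = lim_trans E i' l c')}"

definition completion :: "('k, 'v::ab_group_add, 'i) filtered \<Rightarrow> ('i \<times> ('i \<Rightarrow> 'v set)) set set" where
  "completion E = (SIGMA i:Idx E. inv_lim E i) // colim_rel E"

definition to_completion ::
  "('k, 'v::ab_group_add, 'i) filtered \<Rightarrow> 'v \<Rightarrow> ('i \<times> ('i \<Rightarrow> 'v set)) set" where
  "to_completion E v =
     colim_rel E `` {(i, \<lambda>j\<in>below E i. v +o Fil E j) | i. i \<in> Idx E \<and> v \<in> Fil E i}"

text \<open>The natural map is linear, so being an isomorphism means being bijective.\<close>

definition complete_filtered :: "('k, 'v::ab_group_add, 'i) filtered \<Rightarrow> bool" where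
  "complete_filtered E \<longleftrightarrow> bij_betw (to_completion E) (Vec E) (completion E)"


section \<open>Admissible triples\<close>

definition dominates :: "('k, 'v, 'i) filtered \<Rightarrow> ('k, 'v, 'j) filtered \<Rightarrow> bool" where
  "dominates E E' \<longleftrightarrow>
     Vec E = Vec E' \<and> Scale E = Scale E' \<and>
     (\<exists>\<phi>. \<phi> \<in> Idx E' \<rightarrow> Idx E \<and>
          (\<forall>(i, j)\<in>Ord E'. (\<phi> i, \<phi> j) \<in> Ord E) \<and>
          (\<forall>i\<in>Idx E'. Fil E (\<phi> i) = Fil E' i) \<and>
          (\<forall>j\<in>Idx E. \<exists>i1\<in>Idx E'. \<exists>i2\<in>Idx E'. (\<phi> i1, j) \<in> Ord E \<and> (j, \<phi> i2) \<in> Ord E))"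

definition sub_filtration ::
  "('v \<Rightarrow> 'w) \<Rightarrow> ('k, 'v, 'i) filtered \<Rightarrow> ('k, 'w, 'j) filtered \<Rightarrow> ('k, 'v, 'j) filtered" where
  "sub_filtration \<alpha> E1 E2 =
     \<lparr>Idx = Idx E2, Ord = Ord E2, Fil = (\<lambda>i. {x \<in> Vec E1. \<alpha> x \<in> Fil E2 i}),
      Vec = Vec E1, Scale = Scale E1\<rparr>"

definition quot_filtration ::
  "('v \<Rightarrow> 'w) \<Rightarrow> ('k, 'v, 'i) filtered \<Rightarrow> ('k, 'w, 'j) filtered \<Rightarrow> ('k, 'w, 'i) filtered" where
  "quot_filtration \<beta> E2 E3 =
     \<lparr>Idx = Idx E2, Ord = Ord E2, Fil = (\<lambda>i. \<beta> ` Fil E2 i), Vec = Vec E3, Scale = Scale E3\<rparr>"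

text \<open>Exactness of \<open>0 \<rightarrow> A \<rightarrow> B \<rightarrow> C \<rightarrow> 0\<close> for linear maps \<open>f\<close>, \<open>g\<close>, where \<open>z\<close> is the zero of \<open>C\<close>.\<close>

definition short_exact ::
  "'a set \<Rightarrow> 'b set \<Rightarrow> 'c set \<Rightarrow> 'c \<Rightarrow> ('a \<Rightarrow> 'b) \<Rightarrow> ('b \<Rightarrow> 'c) \<Rightarrow> bool" where
  "short_exact A B C z f g \<longleftrightarrow> inj_on f A \<and> f ` A = {b \<in> B. g b = z} \<and> g ` B = C"

definition admissible_triple ::
  "('v1 \<Rightarrow> 'v2) \<Rightarrow> ('v2 \<Rightarrow> 'v3) \<Rightarrow> ('k::field, 'v1::ab_group_add, 'i1) filtered \<Rightarrow>
   ('k, 'v2::ab_group_add, 'i2) filtered \<Rightarrow> ('k, 'v3::ab_group_add, 'i3) filtered \<Rightarrow> bool" where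
  "admissible_triple \<alpha> \<beta> E1 E2 E3 \<longleftrightarrow>
     C1_space E1 \<and> C1_space E2 \<and> C1_space E3 \<and>
     linear_on (Scale E1) (Scale E2) (Vec E1) \<alpha> \<and>
     linear_on (Scale E2) (Scale E3) (Vec E2) \<beta> \<and>
     short_exact (Vec E1) (Vec E2) (Vec E3) 0 \<alpha> \<beta> \<and>
     (let F1 = Fil (sub_filtration \<alpha> E1 E2); F2 = Fil E2; F3 = Fil (quot_filtration \<beta> E2 E3) in
        dominates E1 (sub_filtration \<alpha> E1 E2) \<and>
        dominates E3 (quot_filtration \<beta> E2 E3) \<and>
        (\<forall>(i, j)\<in>Ord E2.
           short_exact (quot (F1 j) (F1 i)) (quot (F2 j) (F2 i)) (quot (F3 j) (F3 i)) (F3 i)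
             (quot_map \<alpha> (F2 i)) (quot_map \<beta> (F3 i))))"


section \<open>Duals\<close>

text \<open>
  A function on a subset \<open>V\<close> of a type is represented by its extension by zero outside \<open>V\<close>,
  so that equality of functions on \<open>V\<close> is equality in HOL.
\<close>

definition functionals :: "('k::semiring_0 \<Rightarrow> 'v::plus \<Rightarrow> 'v) \<Rightarrow> 'v set \<Rightarrow> ('v \<Rightarrow> 'k) set" where
  "functionals s V = {u. linear_on s (*) V u \<and> (\<forall>x. x \<notin> V \<longrightarrow> u x = 0)}"

definition pullback :: "'v set \<Rightarrow> ('v \<Rightarrow> 'w) \<Rightarrow> ('w \<Rightarrow> 'c::zero) \<Rightarrow> 'v \<Rightarrow> 'c" where
  "pullback V a f = (\<lambda>v. if v \<in> V then f (a v) else 0)"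

definition pointwise_scale :: "'c::times \<Rightarrow> ('x \<Rightarrow> 'c) \<Rightarrow> 'x \<Rightarrow> 'c" where
  "pointwise_scale c f = (\<lambda>x. c * f x)"

definition annihilator :: "('k::field, 'v::ab_group_add, 'i) filtered \<Rightarrow> 'i \<Rightarrow> ('v \<Rightarrow> 'k) set" where
  "annihilator E i = {u \<in> functionals (Scale E) (Vec E). \<forall>x\<in>Fil E i. u x = 0}"

definition dual :: "('k::field, 'v::ab_group_add, 'i) filtered \<Rightarrow> ('k, 'v \<Rightarrow> 'k, 'i) filtered" where
  "dual E =
     \<lparr>Idx = Idx E, Ord = (Ord E)\<inverse>, Fil = annihilator E,
      Vec = (\<Union>i\<in>Idx E. annihilator E i), Scale = pointwise_scale\<rparr>"

text \<open>The dual \<open>u \<mapsto> u \<circ> \<beta>\<close> of a linear map on \<open>Vec E\<close>, and the canonical map to the bidual.\<close>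

definition dual_map :: "('k, 'v, 'i) filtered \<Rightarrow> ('v \<Rightarrow> 'w) \<Rightarrow> ('w \<Rightarrow> 'k::zero) \<Rightarrow> 'v \<Rightarrow> 'k" where
  "dual_map E \<beta> = pullback (Vec E) \<beta>"

definition bidual_map ::
  "('k::field, 'v::ab_group_add, 'i) filtered \<Rightarrow> 'v \<Rightarrow> ('v \<Rightarrow> 'k) \<Rightarrow> 'k" where
  "bidual_map E v = (\<lambda>w. if w \<in> Vec (dual E) then w v else 0)"


section \<open>Functions, distributions and invariant measures\<close>

definition test_functions :: "('k, 'v::ab_group_add, 'i) filtered \<Rightarrow> ('v \<Rightarrow> complex) set" where
  "test_functions E =
     {f. \<exists>(i, j)\<in>Ord E. (\<forall>x. x \<notin> Fil E j \<longrightarrow> f x = 0) \<and>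
           (\<forall>x\<in>Vec E. \<forall>h\<in>Fil E i. f (x + h) = f x)}"

definition distributions ::
  "('k, 'v::ab_group_add, 'i) filtered \<Rightarrow> (('v \<Rightarrow> complex) \<Rightarrow> complex) set" where
  "distributions E = functionals pointwise_scale (test_functions E)"

definition invariant_measures ::
  "('k, 'v::ab_group_add, 'i) filtered \<Rightarrow> (('v \<Rightarrow> complex) \<Rightarrow> complex) set" where
  "invariant_measures E =
     {\<mu> \<in> distributions E. \<forall>f\<in>test_functions E. \<forall>h\<in>Vec E. \<mu> (\<lambda>x. f (x + h)) = \<mu> f}"

text \<open>
  An invariant measure on a \<open>C\<^sub>1\<close>-space is determined by its value on a single \<open>Fil E i\<close>, and any
  family of values with the right index relations arises, so the descriptions below are proper
  (for nonzero \<open>\<mu>\<close> in the first one, and for an admissible triple in the second one).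
\<close>

definition measure_inverse ::
  "('k::field, 'v::ab_group_add, 'i) filtered \<Rightarrow> (('v \<Rightarrow> complex) \<Rightarrow> complex) \<Rightarrow>
   (('v \<Rightarrow> 'k) \<Rightarrow> complex) \<Rightarrow> complex" where
  "measure_inverse E \<mu> =
     (THE \<nu>. \<nu> \<in> invariant_measures (dual E) \<and>
        (\<forall>i\<in>Idx E. \<nu> (indicator (annihilator E i)) = inverse (\<mu> (indicator (Fil E i)))))"

definition measure_tensor ::
  "('v1 \<Rightarrow> 'v2) \<Rightarrow> ('v2 \<Rightarrow> 'v3) \<Rightarrow> ('k, 'v1::ab_group_add, 'i1) filtered \<Rightarrow>
   ('k, 'v2::ab_group_add, 'i2) filtered \<Rightarrow>
   (('v1 \<Rightarrow> complex) \<Rightarrow> complex) \<Rightarrow> (('v3 \<Rightarrow> complex) \<Rightarrow> complex) \<Rightarrow>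
   ('v2 \<Rightarrow> complex) \<Rightarrow> complex" where
  "measure_tensor \<alpha> \<beta> E1 E2 \<mu>1 \<mu>3 =
     (THE \<mu>2. \<mu>2 \<in> invariant_measures E2 \<and>
        (\<forall>j\<in>Idx E2. \<mu>2 (indicator (Fil E2 j)) =
           \<mu>1 (indicator {x \<in> Vec E1. \<alpha> x \<in> Fil E2 j}) * \<mu>3 (indicator (\<beta> ` Fil E2 j))))"

text \<open>\<open>\<mu>\<^sub>1 \<otimes> \<mu>\<^sub>2\<^sup>-\<^sup>1\<close>, that is \<open>\<mu>\<^sub>3\<^sup>-\<^sup>1\<close> for the measure \<open>\<mu>\<^sub>3\<close> with \<open>\<mu>\<^sub>1 \<otimes> \<mu>\<^sub>3 = \<mu>\<^sub>2\<close>.\<close>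

definition measure_tensor_inverse ::
  "('v1 \<Rightarrow> 'v2) \<Rightarrow> ('v2 \<Rightarrow> 'v3) \<Rightarrow> ('k::field, 'v1::ab_group_add, 'i1) filtered \<Rightarrow>
   ('k, 'v2::ab_group_add, 'i2) filtered \<Rightarrow> ('k, 'v3::ab_group_add, 'i3) filtered \<Rightarrow>
   (('v1 \<Rightarrow> complex) \<Rightarrow> complex) \<Rightarrow> (('v2 \<Rightarrow> complex) \<Rightarrow> complex) \<Rightarrow>
   (('v3 \<Rightarrow> 'k) \<Rightarrow> complex) \<Rightarrow> complex" where
  "measure_tensor_inverse \<alpha> \<beta> E1 E2 E3 \<mu>1 \<mu>2 =
     measure_inverse E3
       (THE \<mu>3. \<mu>3 \<in> invariant_measures E3 \<and> measure_tensor \<alpha> \<beta> E1 E2 \<mu>1 \<mu>3 = \<mu>2)"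

definition char_distribution ::
  "('v \<Rightarrow> 'w) \<Rightarrow> ('k, 'v, 'i) filtered \<Rightarrow> ('k, 'w::ab_group_add, 'j) filtered \<Rightarrow>
   (('v \<Rightarrow> complex) \<Rightarrow> complex) \<Rightarrow> ('w \<Rightarrow> complex) \<Rightarrow> complex" where
  "char_distribution a E E' \<mu> =
     (\<lambda>f. if f \<in> test_functions E' then \<mu> (pullback (Vec E) a f) else 0)"


section \<open>Fourier transform\<close>

definition nontrivial_character :: "('k::field \<Rightarrow> complex) \<Rightarrow> bool" where
  "nontrivial_character \<psi> \<longleftrightarrow>
     (\<forall>a b. \<psi> (a + b) = \<psi> a * \<psi> b) \<and> (\<forall>a. \<psi> a \<noteq> 0) \<and> (\<exists>a. \<psi> a \<noteq> 1)"

definition fourier ::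
  "('k::field \<Rightarrow> complex) \<Rightarrow> ('k, 'v::ab_group_add, 'i) filtered \<Rightarrow>
   (('v \<Rightarrow> complex) \<Rightarrow> complex) \<Rightarrow> ('v \<Rightarrow> complex) \<Rightarrow> ('v \<Rightarrow> 'k) \<Rightarrow> complex" where
  "fourier \<psi> E \<mu> f =
     (\<lambda>w. if w \<in> Vec (dual E) then \<mu> (\<lambda>v. f v * cnj (\<psi> (w v))) else 0)"

text \<open>
  For \<open>\<nu>\<close> in the invariant measures of \<open>dual E\<close>: the Fourier transform of a test function on
  \<open>dual E\<close> lives on the bidual and is read as a function on \<open>Vec E\<close> through \<open>bidual_map\<close>,
  the identification of \<open>E\<close> with its bidual for complete \<open>E\<close>.
\<close>

definition fourier_dist ::
  "('k::field \<Rightarrow> complex) \<Rightarrow> ('k, 'v::ab_group_add, 'i) filtered \<Rightarrow>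
   ((('v \<Rightarrow> 'k) \<Rightarrow> complex) \<Rightarrow> complex) \<Rightarrow> (('v \<Rightarrow> complex) \<Rightarrow> complex) \<Rightarrow>
   (('v \<Rightarrow> 'k) \<Rightarrow> complex) \<Rightarrow> complex" where
  "fourier_dist \<psi> E \<nu> G =
     (\<lambda>f. if f \<in> test_functions (dual E)
          then G (pullback (Vec E) (bidual_map E) (fourier \<psi> (dual E) \<nu> f)) else 0)"

end

theory Submission
  imports Defs
begin

text \<open>
  Both sides of (1) are linear in \<open>f\<close>, so it suffices to take for \<open>f\<close> the indicator of a coset
  \<open>x + F\<^sub>2(i)\<close>.  Its Fourier transform is \<open>\<mu>\<^sub>2(F\<^sub>2(i))\<close> times the character \<open>w \<mapsto> cnj (\<psi> (w x))\<close> on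
  the annihilator of \<open>F\<^sub>2(i)\<close>, and it pulls back to a character on the annihilator of
  \<open>\<beta>(F\<^sub>2(i))\<close>, whose integral is nonzero exactly if \<open>\<beta> x \<in> \<beta>(F\<^sub>2(i))\<close>, that is, if the coset meets
  \<open>\<alpha>(V\<^sub>1)\<close>.  In that case both sides equal \<open>\<mu>\<^sub>1(F\<^sub>2(i) \<inter> V\<^sub>1)\<close>.  Applying (1) to the transform of a
  test function on the dual gives (2), by Fourier inversion and the evenness of invariant measures.

  Invariant measures with prescribed values on the \<open>F(i)\<close> exist and are unique as soon as the
  values are compatible with the indices \<open>[F(j) : F(i)]\<close>; for the dual this is
  \<open>[F(i)\<^sup>\<bottom> : F(j)\<^sup>\<bottom>] = [F(j) : F(i)]\<close>.
\<close>

section \<open>Sums over cosets\<close>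

text \<open>Finiteness of the field makes every index \<open>[F(j) : F(i)]\<close> finite, so
  integrals of test functions are finite sums over cosets, and the theorem comes down to counting
  cosets and orthogonality of characters. The obstacle is that \<open>measure_inverse\<close>,
  \<open>measure_tensor\<close> and \<open>measure_tensor_inverse\<close> are definite descriptions:
  nothing can be computed with them before unique existence is known. For the measure on
  \<open>E3\<close> the defining equations speak only of the groups \<open>F3 i\<close>. Domination
  is what makes these groups a second filtration of the same space with the same test functions, so
  that existence and uniqueness can be proved there and carried back. The constants match because
  the transform of a coset contributes \<open>\<mu>2 (F2 i)\<close> and the inverse measure
  contributes the reciprocal of \<open>\<mu>3 (F3 i)\<close>; their product is
  \<open>\<mu>1 (F1 i)\<close> by the choice of \<open>\<mu>3\<close>. Both transforms use the
  conjugate character, so composing them reflects the argument instead of restoring it; this is why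
  evenness of measures enters in (2).\<close>

definition add_subgroup :: "'v::ab_group_add set \<Rightarrow> bool" where
  "add_subgroup A \<longleftrightarrow> 0 \<in> A \<and> (\<forall>x\<in>A. \<forall>y\<in>A. x - y \<in> A)"

lemma add_subgroup_0: "add_subgroup A \<Longrightarrow> 0 \<in> A"
  and add_subgroup_diff: "add_subgroup A \<Longrightarrow> x \<in> A \<Longrightarrow> y \<in> A \<Longrightarrow> x - y \<in> A"
  by (auto simp: add_subgroup_def)

lemma add_subgroup_uminus: "add_subgroup A \<Longrightarrow> x \<in> A \<Longrightarrow> - x \<in> A"
  using add_subgroup_diff[of A 0 x] by (simp add: add_subgroup_0)

lemma add_subgroup_add: "add_subgroup A \<Longrightarrow> x \<in> A \<Longrightarrow> y \<in> A \<Longrightarrow> x + y \<in> A"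
  using add_subgroup_diff[of A x "- y"] by (simp add: add_subgroup_uminus)

lemma add_subgroup_uminus_iff: "add_subgroup A \<Longrightarrow> - x \<in> A \<longleftrightarrow> x \<in> A"
  using add_subgroup_uminus[of A x] add_subgroup_uminus[of A "- x"] by auto

lemma add_subgroup_add_iff: "add_subgroup A \<Longrightarrow> h \<in> A \<Longrightarrow> x + h \<in> A \<longleftrightarrow> x \<in> A"
  using add_subgroup_add[of A x h] add_subgroup_diff[of A "x + h" h] by auto

lemmas add_subgroup_intros =
  add_subgroup_0 add_subgroup_diff add_subgroup_uminus add_subgroup_add

lemma coset_eq_iff:
  assumes "add_subgroup B"
  shows "x +o B = y +o B \<longleftrightarrow> x - y \<in> B"
proof
  assume "x +o B = y +o B"
  moreover have "x \<in> x +o B"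
    using assms by (simp add: add_subgroup_0 flip: set_minus_plus)
  ultimately show "x - y \<in> B" by (simp add: set_minus_plus)
next
  assume *: "x - y \<in> B"
  have "z - x \<in> B \<longleftrightarrow> z - y \<in> B" for z
    using add_subgroup_add[OF assms _ *, of "z - x"] add_subgroup_diff[OF assms _ *, of "z - y"]
    by auto
  then show "x +o B = y +o B"
    by (auto simp flip: set_minus_plus)
qed

lemma coset_eq_self_iff: "add_subgroup B \<Longrightarrow> x +o B = B \<longleftrightarrow> x \<in> B"
  using coset_eq_iff[of B x 0] by simp

definition rep :: "'v set \<Rightarrow> 'v" where
  "rep C = (SOME x. x \<in> C)"

text \<open>For a \<open>B\<close>-invariant function this is its integral over \<open>A\<close>,
  normalised so that \<open>B\<close> has mass one. For such a function the arbitrary choice made by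
  \<open>rep\<close> does not matter, by \<open>inv_rep\<close>.\<close>

definition coset_sum :: "'v::ab_group_add set \<Rightarrow> 'v set \<Rightarrow> ('v \<Rightarrow> complex) \<Rightarrow> complex" where
  "coset_sum A B f = (\<Sum>C\<in>quot A B. f (rep C))"

lemma rep_coset: "add_subgroup B \<Longrightarrow> rep (x +o B) - x \<in> B"
  unfolding rep_def set_minus_plus
  by (rule someI[of _ x]) (simp add: add_subgroup_0 flip: set_minus_plus)

lemma rep_mem: "add_subgroup B \<Longrightarrow> add_subgroup A \<Longrightarrow> B \<subseteq> A \<Longrightarrow> C \<in> quot A B \<Longrightarrow> rep C \<in> A"
  unfolding quot_def using rep_coset[of B] add_subgroup_add[of A]
  by (metis (no_types, lifting) diff_add_cancel imageE subset_iff)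

lemma coset_rep: "add_subgroup B \<Longrightarrow> C \<in> quot A B \<Longrightarrow> rep C +o B = C"
  by (metis (no_types, lifting) coset_eq_iff imageE quot_def rep_coset)

lemma inv_rep:
  assumes "add_subgroup B" "\<And>x h. x \<in> A \<Longrightarrow> h \<in> B \<Longrightarrow> f (x + h) = f x" "x \<in> A"
  shows "f (rep (x +o B)) = f x"
  using assms(2)[OF assms(3) rep_coset[OF assms(1), of x]] by simp

text \<open>Translation by \<open>h\<close> permutes the cosets, and \<open>rep C + h\<close> lies
  in the same coset as \<open>rep (h +o C)\<close>, although the two may differ.\<close>

lemma coset_sum_shift:
  assumes A: "add_subgroup A" and B: "add_subgroup B" and BA: "B \<subseteq> A" and h: "h \<in> A"
    and f: "\<And>x h. x \<in> A \<Longrightarrow> h \<in> B \<Longrightarrow> f (x + h) = f x"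
  shows "coset_sum A B (\<lambda>x. f (x + h)) = coset_sum A B f"
  unfolding coset_sum_def
proof (rule sum.reindex_bij_witness[of _ "\<lambda>C. - h +o C" "\<lambda>C. h +o C"])
  fix C assume C: "C \<in> quot A B"
  show "- h +o (h +o C) = C" "h +o (- h +o C) = C"
    by (simp_all add: set_plus_rearrange2)
  obtain x where x: "x \<in> A" "C = x +o B" using C by (auto simp: quot_def)
  then show "h +o C \<in> quot A B" "- h +o C \<in> quot A B"
    using h A by (auto simp: quot_def set_plus_rearrange2 add_subgroup_intros)
  have "f (rep (h +o C)) = f (h + x)"
    using inv_rep[OF B, of A f "h + x"] f x h A by (simp add: set_plus_rearrange2 add_subgroup_intros)
  also have "\<dots> = f (rep C + h)"
  proof -
    have "f (x + h + (rep C - x)) = f (x + h)"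
      using rep_coset[OF B, of x] x h A by (intro f) (auto simp: add_subgroup_intros)
    then show ?thesis by (simp add: algebra_simps)
  qed
  finally show "f (rep (h +o C)) = f (rep C + h)" .
qed

text \<open>Orthogonality: shifting by \<open>h\<close> leaves the sum unchanged but also multiplies
  it by \<open>\<chi> h\<close>, which is not 1.\<close>

lemma coset_sum_character:
  assumes A: "add_subgroup A" and B: "add_subgroup B" and BA: "B \<subseteq> A"
    and hom: "\<And>x y. x \<in> A \<Longrightarrow> y \<in> A \<Longrightarrow> \<chi> (x + y) = \<chi> x * \<chi> y"
    and triv: "\<And>h. h \<in> B \<Longrightarrow> \<chi> h = 1" and h: "h \<in> A" "\<chi> h \<noteq> 1"
  shows "coset_sum A B \<chi> = 0"
proof -
  have "coset_sum A B \<chi> = coset_sum A B (\<lambda>x. \<chi> (x + h))"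
    using BA hom triv by (intro coset_sum_shift[symmetric, OF A B BA h(1)]) auto
  also have "\<dots> = coset_sum A B \<chi> * \<chi> h"
    using hom h rep_mem[OF B A BA] by (simp add: coset_sum_def sum_distrib_right)
  finally show ?thesis using h by simp
qed

text \<open>Well-definedness of the induced map on quotients. Additivity is asked only at
  \<open>x\<close> and \<open>B\<close>, because the maps in question are linear only on a subspace
  of their type.\<close>

lemma quot_map_coset:
  assumes B: "add_subgroup B" and B': "add_subgroup B'" and fB: "f ` B \<subseteq> B'"
    and f: "\<And>b. b \<in> B \<Longrightarrow> f (x + b) = f x + f b"
  shows "quot_map f B' (x +o B) = f x +o B'"
proof -
  have "f ` (x +o B) + B' = f x +o B'"
  proof (intro set_eqI iffI)
    fix z assume "z \<in> f ` (x +o B) + B'"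
    then obtain b b' where "b \<in> B" "b' \<in> B'" "z = f (x + b) + b'"
      by (auto simp: set_plus_def elt_set_plus_def)
    then have "z - f x = f b + b'" using f by simp
    then have "z - f x \<in> B'"
      using \<open>b \<in> B\<close> \<open>b' \<in> B'\<close> fB B' by (auto intro!: add_subgroup_add)
    then show "z \<in> f x +o B'" by (simp add: set_minus_plus)
  next
    fix z assume "z \<in> f x +o B'"
    moreover have "x \<in> x +o B"
      using B by (simp add: add_subgroup_0 flip: set_minus_plus)
    ultimately show "z \<in> f ` (x +o B) + B'"
      by (metis imageI set_plus_mono3 subsetD)
  qed
  then show ?thesis by (simp add: quot_map_def)
qed

text \<open>The fibres of \<open>A/B \<rightarrow> A'/B'\<close> are the translates of its kernel.\<close>

lemma sum_quot_map:
  fixes h :: "'w::ab_group_add set \<Rightarrow> complex"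
  assumes A: "add_subgroup A" and B: "add_subgroup B" and BA: "B \<subseteq> A"
    and B': "add_subgroup B'"
    and add: "\<And>x y. x \<in> A \<Longrightarrow> y \<in> A \<Longrightarrow> f (x + y) = f x + f y"
    and fA: "f ` A = A'" and fB: "f ` B \<subseteq> B'" and fin: "finite (quot A B)"
  shows "(\<Sum>C\<in>quot A B. h (quot_map f B' C)) =
    of_nat (card {C\<in>quot A B. quot_map f B' C = B'}) * (\<Sum>D\<in>quot A' B'. h D)"
proof -
  have qm: "quot_map f B' (x +o B) = f x +o B'" if "x \<in> A" for x
    using that BA by (intro quot_map_coset[OF B B' fB] add) auto
  have im: "quot_map f B' ` quot A B = quot A' B'"
    unfolding quot_def fA[symmetric] image_image by (rule image_cong) (auto simp: qm)
  have card: "card {C\<in>quot A B. quot_map f B' C = D} = card {C\<in>quot A B. quot_map f B' C = B'}"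
    if D: "D \<in> quot A' B'" for D
  proof -
    obtain x where x: "x \<in> A" "D = f x +o B'" using D unfolding quot_def fA[symmetric] by blast
    have "bij_betw (\<lambda>C. x +o C) {C\<in>quot A B. quot_map f B' C = B'} {C\<in>quot A B. quot_map f B' C = D}"
    proof (rule bij_betw_byWitness[of _ "\<lambda>C. - x +o C"])
      show "\<forall>C\<in>{C \<in> quot A B. quot_map f B' C = B'}. - x +o (x +o C) = C"
        "\<forall>C\<in>{C \<in> quot A B. quot_map f B' C = D}. x +o (- x +o C) = C"
        by (simp_all add: set_plus_rearrange2)
      show "(+o) x ` {C \<in> quot A B. quot_map f B' C = B'} \<subseteq> {C \<in> quot A B. quot_map f B' C = D}"
      proof (rule image_subsetI)
        fix C assume "C \<in> {C \<in> quot A B. quot_map f B' C = B'}"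
        then have "C \<in> quot A B" and k: "quot_map f B' C = B'" by simp_all
        then obtain y where y: "y \<in> A" "C = y +o B" by (auto simp: quot_def)
        have "f y \<in> B'" using k y qm coset_eq_self_iff[OF B'] by auto
        have "x +o C \<in> quot A B"
          using x y A by (auto simp: quot_def set_plus_rearrange2 add_subgroup_intros)
        moreover have "quot_map f B' (x +o C) = D"
          using \<open>f y \<in> B'\<close>
          using x y A by (simp add: set_plus_rearrange2 qm add_subgroup_intros add coset_eq_iff[OF B'])
        ultimately show "x +o C \<in> {C \<in> quot A B. quot_map f B' C = D}" by blast
      qed
      show "(+o) (- x) ` {C \<in> quot A B. quot_map f B' C = D} \<subseteq> {C \<in> quot A B. quot_map f B' C = B'}"
      proof (rule image_subsetI)
        fix C assume "C \<in> {C \<in> quot A B. quot_map f B' C = D}"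
        then have "C \<in> quot A B" and k: "quot_map f B' C = D" by simp_all
        then obtain y where y: "y \<in> A" "C = y +o B" by (auto simp: quot_def)
        have yx: "y - x \<in> A" using x y A by (simp add: add_subgroup_intros)
        have C: "- x +o C = (y - x) +o B" using y by (simp add: set_plus_rearrange2)
        have "- x +o C \<in> quot A B" using yx C by (auto simp: quot_def)
        have "f y - f x \<in> B'" using k y qm x coset_eq_iff[OF B'] by auto
        moreover have "f y = f (y - x) + f x" using add[OF yx x(1)] by simp
        ultimately have "quot_map f B' (- x +o C) = B'"
          using yx by (simp add: C qm coset_eq_self_iff[OF B'])
        with \<open>- x +o C \<in> quot A B\<close> show "- x +o C \<in> {C \<in> quot A B. quot_map f B' C = B'}"
          by blast
      qed
    qed
    then show ?thesis by (rule bij_betw_same_card[symmetric])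
  qed
  have "(\<Sum>C\<in>quot A B. h (quot_map f B' C)) =
      (\<Sum>D\<in>quot A' B'. \<Sum>C\<in>{C\<in>quot A B. quot_map f B' C = D}. h (quot_map f B' C))"
    by (rule sum.group[symmetric]) (use fin im in \<open>auto simp flip: im\<close>)
  also have "\<dots> = (\<Sum>D\<in>quot A' B'. of_nat (card {C\<in>quot A B. quot_map f B' C = D}) * h D)"
    by (intro sum.cong refl) simp
  also have "\<dots> = of_nat (card {C\<in>quot A B. quot_map f B' C = B'}) * (\<Sum>D\<in>quot A' B'. h D)"
    by (simp add: card sum_distrib_left)
  finally show ?thesis .
qed

text \<open>The summand factors through the projection from \<open>A/K\<close> to
  \<open>A/B\<close>, whose kernel is \<open>B/K\<close>, so \<open>sum_quot_map\<close> applies to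
  the identity map.\<close>

lemma coset_sum_refine:
  assumes A: "add_subgroup A" and B: "add_subgroup B" and K: "add_subgroup K"
    and KB: "K \<subseteq> B" and BA: "B \<subseteq> A" and fin: "finite (quot A K)"
    and f: "\<And>x h. x \<in> A \<Longrightarrow> h \<in> B \<Longrightarrow> f (x + h) = f x"
  shows "coset_sum A K f = of_nat (card (quot B K)) * coset_sum A B f"
proof -
  have qm: "quot_map (\<lambda>x. x) B (x +o K) = x +o B" for x
    using KB by (intro quot_map_coset[OF K B]) auto
  have "coset_sum A K f = (\<Sum>C\<in>quot A K. f (rep (quot_map (\<lambda>x. x) B C)))"
    unfolding coset_sum_def
  proof (rule sum.cong[OF refl])
    fix C assume "C \<in> quot A K"
    then obtain x where x: "x \<in> A" "C = x +o K" by (auto simp: quot_def)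
    then show "f (rep C) = f (rep (quot_map (\<lambda>x. x) B C))"
      using inv_rep[OF K _ x(1), where f = f] inv_rep[OF B _ x(1), where f = f] f KB
      by (auto simp: qm subset_iff)
  qed
  also have "\<dots> = of_nat (card {C\<in>quot A K. quot_map (\<lambda>x. x) B C = B}) * coset_sum A B f"
    unfolding coset_sum_def
    by (rule sum_quot_map[OF A K _ B]) (use KB BA fin in auto)
  also have "{C\<in>quot A K. quot_map (\<lambda>x. x) B C = B} = quot B K"
  proof -
    have "{x \<in> A. quot_map (\<lambda>x. x) B (x +o K) = B} = B"
      using BA unfolding qm coset_eq_self_iff[OF B] by auto
    then show ?thesis unfolding quot_def by blast
  qed
  finally show ?thesis .
qed

text \<open>As \<open>B\<close> lies in \<open>A\<close>, a coset of \<open>B\<close> that is not in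
  \<open>quot A B\<close> has its representative outside \<open>A\<close>, where \<open>f\<close>
  vanishes.\<close>

lemma coset_sum_extend:
  assumes A: "add_subgroup A" and B: "add_subgroup B" and L: "add_subgroup L"
    and BA: "B \<subseteq> A" and AL: "A \<subseteq> L" and fin: "finite (quot L B)"
    and f: "\<And>x. x \<in> L \<Longrightarrow> x \<notin> A \<Longrightarrow> f x = 0"
  shows "coset_sum L B f = coset_sum A B f"
  unfolding coset_sum_def
proof (rule sum.mono_neutral_right[OF fin])
  show "quot A B \<subseteq> quot L B" using AL by (auto simp: quot_def)
  show "\<forall>C\<in>quot L B - quot A B. f (rep C) = 0"
  proof
    fix C assume C: "C \<in> quot L B - quot A B"
    then have "rep C \<in> L" "rep C \<notin> A"
      using rep_mem[OF B L] coset_rep[OF B, of C L] BA AL by (auto simp: quot_def)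
    then show "f (rep C) = 0" by (rule f)
  qed
qed

lemma card_quot_pos: "finite (quot A B) \<Longrightarrow> add_subgroup A \<Longrightarrow> card (quot A B) > 0"
  unfolding card_gt_0_iff by (auto simp: quot_def add_subgroup_def)

section \<open>Invariant measures\<close>

text \<open>The witnesses of membership in \<open>test_functions\<close> become parameters, because
  the finite sum that computes an integral is taken over \<open>Fil E j\<close> modulo
  \<open>Fil E i\<close>.\<close>

definition adapted ::
  "('k, 'v::ab_group_add, 'i) filtered \<Rightarrow> 'i \<Rightarrow> 'i \<Rightarrow> ('v \<Rightarrow> complex) \<Rightarrow> bool" where
  "adapted E i j f \<longleftrightarrow> (i, j) \<in> Ord E \<and> (\<forall>x. x \<notin> Fil E j \<longrightarrow> f x = 0) \<and>
     (\<forall>x\<in>Vec E. \<forall>h\<in>Fil E i. f (x + h) = f x)"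

lemma test_functions_iff: "f \<in> test_functions E \<longleftrightarrow> (\<exists>i j. adapted E i j f)"
  by (auto simp: test_functions_def adapted_def)

lemma test_functionsI: "adapted E i j f \<Longrightarrow> f \<in> test_functions E"
  by (auto simp: test_functions_iff)

text \<open>
  The measure theory uses only the additive groups of the filtration, so that it applies alike to
  \<open>E\<close>, to its dual and to the filtration \<open>\<beta> (F\<^sub>2 i)\<close>.
\<close>

locale filtered_group =
  fixes E :: "('k, 'v::ab_group_add, 'i) filtered"
  assumes Idx_nonempty: "Idx E \<noteq> {}"
    and Ord_Idx: "(i, j) \<in> Ord E \<Longrightarrow> i \<in> Idx E \<and> j \<in> Idx E"
    and Ord_refl: "i \<in> Idx E \<Longrightarrow> (i, i) \<in> Ord E"
    and Ord_trans: "(i, j) \<in> Ord E \<Longrightarrow> (j, k) \<in> Ord E \<Longrightarrow> (i, k) \<in> Ord E"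
    and directed: "i \<in> Idx E \<Longrightarrow> j \<in> Idx E \<Longrightarrow>
      \<exists>k l. (k, i) \<in> Ord E \<and> (i, l) \<in> Ord E \<and> (k, j) \<in> Ord E \<and> (j, l) \<in> Ord E"
    and Fil_subgroup: "i \<in> Idx E \<Longrightarrow> add_subgroup (Fil E i)"
    and Fil_mono: "(i, j) \<in> Ord E \<Longrightarrow> Fil E i \<subseteq> Fil E j"
    and Fil_UN: "(\<Union>i\<in>Idx E. Fil E i) = Vec E"
    and finite_index: "(i, j) \<in> Ord E \<Longrightarrow> finite (quot (Fil E j) (Fil E i))"
begin

lemma Fil_subset_Vec: "i \<in> Idx E \<Longrightarrow> Fil E i \<subseteq> Vec E"
  using Fil_UN by auto

lemma Vec_cases: "x \<in> Vec E \<Longrightarrow> (\<And>i. i \<in> Idx E \<Longrightarrow> x \<in> Fil E i \<Longrightarrow> P) \<Longrightarrow> P"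
  using Fil_UN by auto

lemma upper: "i \<in> Idx E \<Longrightarrow> j \<in> Idx E \<Longrightarrow> \<exists>l. (i, l) \<in> Ord E \<and> (j, l) \<in> Ord E"
  and lower: "i \<in> Idx E \<Longrightarrow> j \<in> Idx E \<Longrightarrow> \<exists>k. (k, i) \<in> Ord E \<and> (k, j) \<in> Ord E"
  using directed by blast+

lemma Vec_above:
  assumes "x \<in> Vec E" "i \<in> Idx E"
  obtains j where "(i, j) \<in> Ord E" "x \<in> Fil E j"
proof -
  obtain k where k: "k \<in> Idx E" "x \<in> Fil E k" using assms(1) by (rule Vec_cases)
  then obtain j where "(i, j) \<in> Ord E" "(k, j) \<in> Ord E" using upper assms(2) by blast
  with k Fil_mono show thesis by (blast intro: that)
qed

lemma Vec_subgroup: "add_subgroup (Vec E)"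
  unfolding add_subgroup_def
proof (intro conjI ballI)
  obtain i where "i \<in> Idx E" using Idx_nonempty by auto
  then show "0 \<in> Vec E" using Fil_subgroup Fil_subset_Vec add_subgroup_0 by blast
next
  fix x y assume x: "x \<in> Vec E" and y: "y \<in> Vec E"
  obtain i where i: "i \<in> Idx E" "x \<in> Fil E i" using x by (rule Vec_cases)
  obtain j where j: "(i, j) \<in> Ord E" "y \<in> Fil E j" using Vec_above y i by blast
  then have "x - y \<in> Fil E j"
    using i Fil_mono[OF j(1)] Fil_subgroup[of j] Ord_Idx[OF j(1)]
    by (intro add_subgroup_diff) auto
  then show "x - y \<in> Vec E" using Fil_subset_Vec Ord_Idx j by blast
qed

lemma Vec_add: "x \<in> Vec E \<Longrightarrow> y \<in> Vec E \<Longrightarrow> x + y \<in> Vec E"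
  using Vec_subgroup by (rule add_subgroup_add)

section \<open>Stability of test functions and their decomposition into cosets\<close>

lemma adapted_mono:
  assumes "adapted E i j f" "(k, i) \<in> Ord E" "(j, l) \<in> Ord E"
  shows "adapted E k l f"
proof -
  have "(k, l) \<in> Ord E"
    using assms(1) Ord_trans[OF assms(2)] Ord_trans[OF _ assms(3)] unfolding adapted_def by blast
  then show ?thesis
    using assms(1) Fil_mono[OF assms(2)] Fil_mono[OF assms(3)] unfolding adapted_def
    by (auto simp: subset_iff)
qed

lemma adapted_Ord: "adapted E i j f \<Longrightarrow> (i, j) \<in> Ord E"
  by (simp add: adapted_def)

lemma adapted_common:
  assumes "f \<in> test_functions E" "g \<in> test_functions E"
  obtains i j where "adapted E i j f" "adapted E i j g"
proof -
  obtain i j i' j' where f: "adapted E i j f" and g: "adapted E i' j' g"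
    using assms by (auto simp: test_functions_iff)
  have Idx: "i \<in> Idx E" "j \<in> Idx E" "i' \<in> Idx E" "j' \<in> Idx E"
    using f g adapted_Ord Ord_Idx by blast+
  obtain k where "(k, i) \<in> Ord E" "(k, i') \<in> Ord E" using lower Idx by blast
  moreover obtain l where "(j, l) \<in> Ord E" "(j', l) \<in> Ord E" using upper Idx by blast
  ultimately show thesis using that adapted_mono[OF f] adapted_mono[OF g] by blast
qed

lemma test_add:
  assumes "f \<in> test_functions E" "g \<in> test_functions E"
  shows "(\<lambda>x. f x + g x) \<in> test_functions E"
proof -
  obtain i j where "adapted E i j f" "adapted E i j g" using adapted_common assms by blast
  then have "adapted E i j (\<lambda>x. f x + g x)" by (simp add: adapted_def)
  then show ?thesis by (rule test_functionsI)
qed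

lemma test_scale: "f \<in> test_functions E \<Longrightarrow> (\<lambda>x. c * f x) \<in> test_functions E"
  unfolding test_functions_iff adapted_def by fastforce

lemma adapted_shift:
  assumes f: "adapted E i j f" and h: "h \<in> Fil E j"
  shows "adapted E i j (\<lambda>x. f (x + h))"
proof -
  have "h \<in> Vec E" using h f Fil_subset_Vec Ord_Idx unfolding adapted_def by blast
  moreover have "add_subgroup (Fil E j)" using f Ord_Idx Fil_subgroup unfolding adapted_def by blast
  moreover have "f (x + k + h) = f (x + h)" if "x \<in> Vec E" "k \<in> Fil E i" for x k
  proof -
    have "f (x + h + k) = f (x + h)"
      using f that Vec_add[OF that(1) \<open>h \<in> Vec E\<close>] unfolding adapted_def by blast
    then show ?thesis by (simp add: algebra_simps)
  qed
  ultimately show ?thesis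
    using f h unfolding adapted_def by (auto simp: add_subgroup_add_iff)
qed

text \<open>Prepares a shift by an arbitrary \<open>h\<close>: once \<open>h\<close> lies in the
  supporting subgroup, \<open>adapted_shift\<close> keeps the same pair of indices.\<close>

lemma test_adapted_Vec:
  assumes "f \<in> test_functions E" "h \<in> Vec E"
  obtains i j where "adapted E i j f" "h \<in> Fil E j"
proof -
  obtain i j where f: "adapted E i j f" using assms(1) by (auto simp: test_functions_iff)
  then have ij: "i \<in> Idx E" "j \<in> Idx E" using adapted_Ord Ord_Idx by blast+
  obtain l where l: "(j, l) \<in> Ord E" "h \<in> Fil E l" using assms(2) ij(2) by (rule Vec_above)
  show thesis using that[OF adapted_mono[OF f Ord_refl[OF ij(1)] l(1)] l(2)] .
qed

text \<open>The factor \<open>g\<close> need not have bounded support; it will be a character that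
  is trivial on some \<open>Fil E k\<close>.\<close>

lemma test_times:
  assumes "f \<in> test_functions E" and k: "k \<in> Idx E"
    and g: "\<And>x h. x \<in> Vec E \<Longrightarrow> h \<in> Fil E k \<Longrightarrow> g (x + h) = g x"
  shows "(\<lambda>x. f x * g x) \<in> test_functions E"
proof -
  obtain i j where ij: "adapted E i j f" using assms(1) by (auto simp: test_functions_iff)
  obtain l where l: "(l, i) \<in> Ord E" "(l, k) \<in> Ord E" using lower k ij Ord_Idx adapted_Ord by blast
  then have "adapted E l j f" using ij adapted_mono Ord_refl Ord_Idx adapted_Ord by blast
  then have "adapted E l j (\<lambda>x. f x * g x)"
    using g Fil_mono[OF l(2)] unfolding adapted_def by (auto simp: subset_iff)
  then show ?thesis by (rule test_functionsI)
qed

lemma adapted_coset: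
  assumes ij: "(i, j) \<in> Ord E" and x: "x \<in> Fil E j"
  shows "adapted E i j (indicator (x +o Fil E i))"
proof -
  have i: "add_subgroup (Fil E i)" and j: "add_subgroup (Fil E j)"
    using ij Ord_Idx Fil_subgroup by blast+
  have "y \<in> Fil E j" if "y - x \<in> Fil E i" for y
    using that x Fil_mono[OF ij] add_subgroup_add[OF j, of "y - x" x] by auto
  moreover have "y + h - x \<in> Fil E i \<longleftrightarrow> y - x \<in> Fil E i" if "h \<in> Fil E i" for y h
    using add_subgroup_add_iff[OF i that, of "y - x"] by (simp add: algebra_simps)
  ultimately show ?thesis
    using ij unfolding adapted_def by (auto simp: indicator_def simp flip: set_minus_plus)
qed

lemma test_coset: "x \<in> Vec E \<Longrightarrow> i \<in> Idx E \<Longrightarrow> indicator (x +o Fil E i) \<in> test_functions E"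
  by (elim Vec_above) (auto intro: test_functionsI adapted_coset)

lemma adapted_Fil: "i \<in> Idx E \<Longrightarrow> adapted E i i (indicator (Fil E i))"
  using adapted_coset[of i i 0] Ord_refl add_subgroup_0[OF Fil_subgroup] by simp

lemma test_Fil: "i \<in> Idx E \<Longrightarrow> indicator (Fil E i) \<in> test_functions E"
  by (rule test_functionsI[OF adapted_Fil])

lemma test_sum:
  "finite S \<Longrightarrow> (\<And>C. C \<in> S \<Longrightarrow> g C \<in> test_functions E) \<Longrightarrow>
    (\<lambda>x. \<Sum>C\<in>S. c C * g C x) \<in> test_functions E"
proof (induction rule: finite_induct)
  case empty
  obtain i where "i \<in> Idx E" using Idx_nonempty by auto
  then show ?case using test_scale[OF test_Fil, of i 0] by simp
next
  case (insert C S)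
  then have "(\<lambda>x. c C * g C x + (\<Sum>C\<in>S. c C * g C x)) \<in> test_functions E"
    by (intro test_add test_scale) auto
  with insert show ?case by simp
qed

text \<open>The function is constant on each of the finitely many cosets of \<open>Fil E i\<close>
  in \<open>Fil E j\<close>. At most one indicator in the sum is nonzero at a given point, and none
  is outside \<open>Fil E j\<close>.\<close>

lemma adapted_decomp:
  assumes "adapted E i j f"
  shows "f = (\<lambda>x. \<Sum>C\<in>quot (Fil E j) (Fil E i). f (rep C) * indicator C x)"
proof
  fix x
  have ij: "(i, j) \<in> Ord E" using assms by (rule adapted_Ord)
  then have i: "add_subgroup (Fil E i)" and j: "add_subgroup (Fil E j)"
    using Ord_Idx Fil_subgroup by blast+
  have mem: "x \<in> C \<longleftrightarrow> C = x +o Fil E i \<and> x \<in> Fil E j" if "C \<in> quot (Fil E j) (Fil E i)" for C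
  proof -
    obtain y where y: "y \<in> Fil E j" "C = y +o Fil E i" using \<open>C \<in> quot (Fil E j) (Fil E i)\<close> unfolding quot_def by blast
    have "x \<in> Fil E j" if "x - y \<in> Fil E i"
      using that y Fil_mono[OF ij] add_subgroup_add[OF j, of "x - y" y] by auto
    moreover have "x \<in> C \<longleftrightarrow> x - y \<in> Fil E i" using y by (simp flip: set_minus_plus)
    moreover have "C = x +o Fil E i \<longleftrightarrow> x - y \<in> Fil E i"
      using y coset_eq_iff[OF i, of x y] by metis
    ultimately show ?thesis by blast
  qed
  show "f x = (\<Sum>C\<in>quot (Fil E j) (Fil E i). f (rep C) * indicator C x)"
  proof (cases "x \<in> Fil E j")
    case True
    then have q: "x +o Fil E i \<in> quot (Fil E j) (Fil E i)" by (auto simp: quot_def)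
    have "(\<Sum>C\<in>quot (Fil E j) (Fil E i). f (rep C) * indicator C x) =
        (\<Sum>C\<in>quot (Fil E j) (Fil E i). if C = x +o Fil E i then f (rep C) else 0)"
      using mem True by (intro sum.cong) (auto simp: indicator_def)
    also have "\<dots> = f (rep (x +o Fil E i))"
      using q finite_index[OF ij] by simp
    also have "\<dots> = f x"
      using assms True Fil_subset_Vec Ord_Idx unfolding adapted_def
      by (intro inv_rep[OF i, of "Fil E j" f]) blast+
    finally show ?thesis by simp
  next
    case False
    then show ?thesis using mem assms unfolding adapted_def
      by (metis (no_types, lifting) indicator_simps(2) mult_zero_right sum.neutral)
  qed
qed

text \<open>Reduces a linear claim to cosets of single filtration subgroups. The rules for scaling
  and addition supply membership in \<open>test_functions\<close> because measures are linear only
  there.\<close>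

lemma test_function_induct [consumes 1, case_names coset scale add]:
  assumes f: "f \<in> test_functions E"
    and coset: "\<And>x i. x \<in> Vec E \<Longrightarrow> i \<in> Idx E \<Longrightarrow> P (indicator (x +o Fil E i))"
    and scale: "\<And>f c. f \<in> test_functions E \<Longrightarrow> P f \<Longrightarrow> P (\<lambda>x. c * f x)"
    and add: "\<And>f g. f \<in> test_functions E \<Longrightarrow> g \<in> test_functions E \<Longrightarrow> P f \<Longrightarrow> P g \<Longrightarrow>
      P (\<lambda>x. f x + g x)"
  shows "P f"
proof -
  obtain i j where ij: "adapted E i j f" using f by (auto simp: test_functions_iff)
  then have ord: "(i, j) \<in> Ord E" by (rule adapted_Ord)
  have C: "indicator C \<in> test_functions E \<and> P (indicator C)" if "C \<in> quot (Fil E j) (Fil E i)" for C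
    using that ord coset test_coset Ord_Idx Fil_subset_Vec unfolding quot_def by blast
  have "P (\<lambda>x. \<Sum>C\<in>S. f (rep C) * indicator C x)"
    if "finite S" "S \<subseteq> quot (Fil E j) (Fil E i)" for S
    using that
  proof (induction rule: finite_induct)
    case empty
    \<comment> \<open>The empty sum is reached as zero times the indicator of a coset, so the rule
      needs no separate case for the zero function.\<close>
    have "0 \<in> Vec E" using Vec_subgroup by (rule add_subgroup_0)
    then have "P (\<lambda>x. 0 * indicator (0 +o Fil E i) x)"
      using ord Ord_Idx by (intro scale coset test_coset) auto
    then show ?case by simp
  next
    case (insert D S)
    then have "P (\<lambda>x. f (rep D) * indicator D x + (\<Sum>C\<in>S. f (rep C) * indicator C x))"
      using C by (intro add scale test_scale test_sum) auto
    with insert show ?case by simp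
  qed
  then have "P (\<lambda>x. \<Sum>C\<in>quot (Fil E j) (Fil E i). f (rep C) * indicator C x)"
    using finite_index[OF ord] by blast
  then show ?thesis using adapted_decomp[OF ij] by simp
qed

section \<open>Evaluation, uniqueness and existence of invariant measures\<close>

lemma invariant_measure_iff:
  "\<mu> \<in> invariant_measures E \<longleftrightarrow>
    (\<forall>f\<in>test_functions E. \<forall>g\<in>test_functions E. \<mu> (\<lambda>x. f x + g x) = \<mu> f + \<mu> g) \<and>
    (\<forall>c. \<forall>f\<in>test_functions E. \<mu> (\<lambda>x. c * f x) = c * \<mu> f) \<and>
    (\<forall>f. f \<notin> test_functions E \<longrightarrow> \<mu> f = 0) \<and>
    (\<forall>f\<in>test_functions E. \<forall>h\<in>Vec E. \<mu> (\<lambda>x. f (x + h)) = \<mu> f)"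
  by (auto simp: invariant_measures_def distributions_def functionals_def linear_on_def
      pointwise_scale_def plus_fun_def)

context
  fixes \<mu> :: "('v \<Rightarrow> complex) \<Rightarrow> complex"
  assumes \<mu>: "\<mu> \<in> invariant_measures E"
begin

lemma measure_add:
    "f \<in> test_functions E \<Longrightarrow> g \<in> test_functions E \<Longrightarrow> \<mu> (\<lambda>x. f x + g x) = \<mu> f + \<mu> g"
  and measure_scale: "f \<in> test_functions E \<Longrightarrow> \<mu> (\<lambda>x. c * f x) = c * \<mu> f"
  and measure_outside: "f \<notin> test_functions E \<Longrightarrow> \<mu> f = 0"
  and measure_shift: "f \<in> test_functions E \<Longrightarrow> h \<in> Vec E \<Longrightarrow> \<mu> (\<lambda>x. f (x + h)) = \<mu> f"
  using \<mu> unfolding invariant_measure_iff by auto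

lemma measure_zero: "\<mu> (\<lambda>x. 0) = 0"
proof (cases "(\<lambda>x. 0) \<in> test_functions E")
  case True
  from measure_scale[OF this, of 0] show ?thesis by simp
qed (rule measure_outside)

lemma measure_sum:
  "finite S \<Longrightarrow> (\<And>C. C \<in> S \<Longrightarrow> g C \<in> test_functions E) \<Longrightarrow>
    \<mu> (\<lambda>x. \<Sum>C\<in>S. c C * g C x) = (\<Sum>C\<in>S. c C * \<mu> (g C))"
proof (induction rule: finite_induct)
  case (insert C S)
  then have "\<mu> (\<lambda>x. c C * g C x + (\<Sum>C\<in>S. c C * g C x)) =
      \<mu> (\<lambda>x. c C * g C x) + \<mu> (\<lambda>x. \<Sum>C\<in>S. c C * g C x)"
    by (intro measure_add test_scale test_sum) auto
  with insert show ?case by (simp add: measure_scale)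
qed (simp add: measure_zero)

lemma measure_coset:
  assumes "x \<in> Vec E" "i \<in> Idx E"
  shows "\<mu> (indicator (x +o Fil E i)) = \<mu> (indicator (Fil E i))"
proof -
  have "\<mu> (\<lambda>y. indicator (x +o Fil E i) (y + x)) = \<mu> (indicator (x +o Fil E i))"
    using assms by (intro measure_shift test_coset)
  moreover have "(\<lambda>y. indicator (x +o Fil E i) (y + x)) = (indicator (Fil E i) :: _ \<Rightarrow> complex)"
    by (auto simp: indicator_def fun_eq_iff simp flip: set_minus_plus)
  ultimately show ?thesis by simp
qed

text \<open>All cosets of \<open>Fil E i\<close> have the same mass, so after decomposing
  \<open>f\<close> a single unknown number remains. Uniqueness follows from this formula, and
  \<open>measure_exists\<close> uses it as a definition.\<close>

lemma measure_formula:
  assumes "adapted E i j f"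
  shows "\<mu> f = \<mu> (indicator (Fil E i)) * coset_sum (Fil E j) (Fil E i) f"
proof -
  have ij: "(i, j) \<in> Ord E" using assms by (rule adapted_Ord)
  have C: "indicator C \<in> test_functions E \<and> \<mu> (indicator C) = \<mu> (indicator (Fil E i))"
    if "C \<in> quot (Fil E j) (Fil E i)" for C
    using that ij measure_coset test_coset Ord_Idx Fil_subset_Vec unfolding quot_def by blast
  have "\<mu> f = \<mu> (\<lambda>x. \<Sum>C\<in>quot (Fil E j) (Fil E i). f (rep C) * indicator C x)"
    using adapted_decomp[OF assms] by simp
  also have "\<dots> = (\<Sum>C\<in>quot (Fil E j) (Fil E i). f (rep C) * \<mu> (indicator C))"
    using C finite_index[OF ij] by (intro measure_sum) auto
  also have "\<dots> = (\<Sum>C\<in>quot (Fil E j) (Fil E i). f (rep C) * \<mu> (indicator (Fil E i)))"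
    using C by (intro sum.cong) auto
  finally show ?thesis by (simp add: coset_sum_def sum_distrib_left mult.commute)
qed

text \<open>The compatibility forced on the masses of the filtration subgroups;
  \<open>measure_exists\<close> shows that it is also sufficient.\<close>

lemma measure_Fil:
  assumes "(i, j) \<in> Ord E"
  shows "\<mu> (indicator (Fil E j)) = of_nat (card (quot (Fil E j) (Fil E i))) * \<mu> (indicator (Fil E i))"
proof -
  have i: "add_subgroup (Fil E i)" and j: "add_subgroup (Fil E j)"
    using Ord_Idx assms Fil_subgroup by blast+
  have "adapted E i j (indicator (Fil E j))"
    using adapted_mono[OF adapted_Fil] assms Ord_Idx Ord_refl by blast
  then have "\<mu> (indicator (Fil E j)) =
      \<mu> (indicator (Fil E i)) * coset_sum (Fil E j) (Fil E i) (indicator (Fil E j))"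
    by (rule measure_formula)
  also have "coset_sum (Fil E j) (Fil E i) (indicator (Fil E j)) = of_nat (card (quot (Fil E j) (Fil E i)))"
    using rep_mem[OF i j Fil_mono[OF assms]] by (simp add: coset_sum_def)
  finally show ?thesis by simp
qed

text \<open>If one mass vanished, so would the mass of every smaller subgroup, as the index is a
  positive factor. Every test function is invariant under some smaller subgroup, hence would have
  integral zero.\<close>

lemma measure_nonzero:
  assumes "\<mu> \<noteq> 0" "i \<in> Idx E"
  shows "\<mu> (indicator (Fil E i)) \<noteq> 0"
proof
  assume 0: "\<mu> (indicator (Fil E i)) = 0"
  have "\<mu> f = 0" for f
  proof (cases "f \<in> test_functions E")
    case True
    then obtain k l where kl: "adapted E k l f" by (auto simp: test_functions_iff)
    then obtain m where m: "(m, i) \<in> Ord E" "(m, k) \<in> Ord E"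
      using lower[OF assms(2)] Ord_Idx adapted_Ord by metis
    then have "adapted E m l f" using kl adapted_mono Ord_refl Ord_Idx adapted_Ord by metis
    moreover have "\<mu> (indicator (Fil E m)) = 0"
      using measure_Fil[OF m(1)] 0 card_quot_pos[OF finite_index[OF m(1)]] Fil_subgroup assms(2)
      by simp
    ultimately show ?thesis using measure_formula by simp
  qed (rule measure_outside)
  then show False using assms(1) by (auto simp: fun_eq_iff)
qed

end

lemma measure_unique:
  assumes "\<mu> \<in> invariant_measures E" "\<nu> \<in> invariant_measures E"
    and "\<And>i. i \<in> Idx E \<Longrightarrow> \<mu> (indicator (Fil E i)) = \<nu> (indicator (Fil E i))"
  shows "\<mu> = \<nu>"
proof
  fix f show "\<mu> f = \<nu> f"
  proof (cases "f \<in> test_functions E")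
    case True
    then obtain i j where "adapted E i j f" by (auto simp: test_functions_iff)
    then show ?thesis
      using assms(3)[of i] measure_formula[OF assms(1)] measure_formula[OF assms(2)] Ord_Idx adapted_Ord
      by metis
  qed (simp add: measure_outside[OF assms(1)] measure_outside[OF assms(2)])
qed

text \<open>The value of \<open>measure_formula\<close> is taken as the definition. The relation on
  \<open>m\<close> is exactly what makes it independent of the pair of indices, by passing to a
  common wider pair.\<close>

lemma measure_exists:
  fixes m :: "'i \<Rightarrow> complex"
  assumes m: "\<And>i j. (i, j) \<in> Ord E \<Longrightarrow> m j = of_nat (card (quot (Fil E j) (Fil E i))) * m i"
  shows "\<exists>\<mu>\<in>invariant_measures E. \<forall>i\<in>Idx E. \<mu> (indicator (Fil E i)) = m i"
proof -
  define S where "S i j f = m i * coset_sum (Fil E j) (Fil E i) f" for i j f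
  \<comment> \<open>Refining \<open>i\<close> to \<open>k\<close> multiplies the sum by the index of
    \<open>Fil E k\<close> in \<open>Fil E i\<close>, which is also the ratio of \<open>m i\<close>
    to \<open>m k\<close>. Enlarging \<open>j\<close> to \<open>l\<close> adds only zero
    terms.\<close>
  have S_refine: "S k l f = S i j f"
    if f: "adapted E i j f" and ki: "(k, i) \<in> Ord E" and jl: "(j, l) \<in> Ord E" for i j k l f
  proof -
    have ij: "(i, j) \<in> Ord E" using f by (rule adapted_Ord)
    have sub: "add_subgroup (Fil E i)" "add_subgroup (Fil E j)" "add_subgroup (Fil E k)" "add_subgroup (Fil E l)"
      using ij ki jl Ord_Idx Fil_subgroup by blast+
    have fin: "finite (quot (Fil E l) (Fil E k))" "finite (quot (Fil E l) (Fil E i))"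
      using finite_index Ord_trans ki ij jl by blast+
    have il: "(i, l) \<in> Ord E" using Ord_trans ij jl by blast
    have "coset_sum (Fil E l) (Fil E k) f =
        of_nat (card (quot (Fil E i) (Fil E k))) * coset_sum (Fil E l) (Fil E i) f"
    proof (rule coset_sum_refine[OF sub(4,1,3) Fil_mono[OF ki] Fil_mono[OF il] fin(1)])
      show "f (x + h) = f x" if "x \<in> Fil E l" "h \<in> Fil E i" for x h
        using f that Fil_subset_Vec il Ord_Idx unfolding adapted_def by blast
    qed
    also have "coset_sum (Fil E l) (Fil E i) f = coset_sum (Fil E j) (Fil E i) f"
      using f unfolding adapted_def
      by (intro coset_sum_extend[OF sub(2,1,4) Fil_mono[OF ij] Fil_mono[OF jl] fin(2)]) blast
    finally show ?thesis by (simp add: S_def m[OF ki])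
  qed
  have S_indep: "S i j f = S i' j' f" if f: "adapted E i j f" "adapted E i' j' f" for i j i' j' f
  proof -
    have "i \<in> Idx E" "j \<in> Idx E" "i' \<in> Idx E" "j' \<in> Idx E"
      using f adapted_Ord Ord_Idx by blast+
    then obtain k l where "(k, i) \<in> Ord E" "(k, i') \<in> Ord E" "(j, l) \<in> Ord E" "(j', l) \<in> Ord E"
      using lower[of i i'] upper[of j j'] by blast
    then show ?thesis using S_refine[OF f(1)] S_refine[OF f(2)] by metis
  qed
  \<comment> \<open>For a test function any pair of witnesses gives the same value, by
    \<open>S_indep\<close>. Elsewhere the value is 0 because distributions are represented by their
    extension by zero.\<close>
  define I where "I = (\<lambda>f. if f \<in> test_functions E
    then S (SOME i. \<exists>j. adapted E i j f) (SOME j. adapted E (SOME i. \<exists>j. adapted E i j f) j f) f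
    else 0)"
  have I: "I f = S i j f" if "adapted E i j f" for i j f
  proof -
    have "\<exists>j. adapted E (SOME i. \<exists>j. adapted E i j f) j f"
      using that by (intro someI_ex[where P = "\<lambda>i. \<exists>j. adapted E i j f"]) blast
    then have "adapted E (SOME i. \<exists>j. adapted E i j f)
        (SOME j. adapted E (SOME i. \<exists>j. adapted E i j f) j f) f"
      by (rule someI_ex)
    then show ?thesis
      using that S_indep test_functionsI[OF that] unfolding I_def by metis
  qed
  have "I \<in> invariant_measures E"
    unfolding invariant_measure_iff
  proof (intro conjI ballI allI impI)
    fix f g assume "f \<in> test_functions E" "g \<in> test_functions E"
    then obtain i j where ij: "adapted E i j f" "adapted E i j g" by (rule adapted_common)
    then have "adapted E i j (\<lambda>x. f x + g x)" by (simp add: adapted_def)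
    with ij show "I (\<lambda>x. f x + g x) = I f + I g"
      by (simp add: I S_def coset_sum_def sum.distrib distrib_left)
  next
    fix c f assume "f \<in> test_functions E"
    then obtain i j where ij: "adapted E i j f" by (auto simp: test_functions_iff)
    then have "adapted E i j (\<lambda>x. c * f x)" by (simp add: adapted_def)
    with ij show "I (\<lambda>x. c * f x) = c * I f"
      by (simp add: I S_def coset_sum_def sum_distrib_left mult_ac)
  next
    fix f assume "f \<notin> test_functions E"
    then show "I f = 0" by (simp add: I_def)
  next
    fix f h assume "f \<in> test_functions E" "h \<in> Vec E"
    then obtain i j where ij: "adapted E i j f" "h \<in> Fil E j" by (rule test_adapted_Vec)
    have ord: "(i, j) \<in> Ord E" using ij(1) by (rule adapted_Ord)
    have "coset_sum (Fil E j) (Fil E i) (\<lambda>x. f (x + h)) = coset_sum (Fil E j) (Fil E i) f"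
    proof (rule coset_sum_shift)
      show "add_subgroup (Fil E j)" "add_subgroup (Fil E i)"
        using ord Ord_Idx Fil_subgroup by blast+
      show "f (x + h) = f x" if "x \<in> Fil E j" "h \<in> Fil E i" for x h
        using ij(1) that Fil_subset_Vec ord Ord_Idx unfolding adapted_def by blast
    qed (use ord ij Fil_mono in auto)
    then show "I (\<lambda>x. f (x + h)) = I f"
      using I[OF ij(1)] I[OF adapted_shift[OF ij]] by (simp add: S_def)
  qed
  moreover have "I (indicator (Fil E i)) = m i" if i: "i \<in> Idx E" for i
  proof -
    have sub: "add_subgroup (Fil E i)" using i by (rule Fil_subgroup)
    \<comment> \<open>The quotient of \<open>Fil E i\<close> by itself is a single coset, so the sum
      is the value 1 at its representative.\<close>
    have "x +o Fil E i = Fil E i" if "x \<in> Fil E i" for x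
      using that coset_eq_self_iff[OF sub] by blast
    then have "quot (Fil E i) (Fil E i) = {Fil E i}"
      using add_subgroup_0[OF sub] unfolding quot_def by (auto simp del: set_zero_plus)
    moreover have "rep (Fil E i) \<in> Fil E i" using rep_coset[OF sub, of 0] by simp
    ultimately show ?thesis by (simp add: I[OF adapted_Fil[OF i]] S_def coset_sum_def)
  qed
  ultimately show ?thesis by blast
qed

text \<open>Reflecting an invariant measure gives an invariant measure with the same masses, since
  subgroups are symmetric; uniqueness identifies the two.\<close>

lemma measure_uminus:
  assumes \<mu>: "\<mu> \<in> invariant_measures E"
  shows "\<mu> (\<lambda>x. f (- x)) = \<mu> f"
proof -
  have neg: "(\<lambda>x. f (- x)) \<in> test_functions E" if "f \<in> test_functions E" for f
  proof -
    obtain i j where ij: "adapted E i j f" using \<open>f \<in> test_functions E\<close> by (auto simp: test_functions_iff)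
    have ord: "(i, j) \<in> Ord E" using ij by (rule adapted_Ord)
    have i: "add_subgroup (Fil E i)" and j: "add_subgroup (Fil E j)"
      using ord Ord_Idx Fil_subgroup by blast+
    have "f (- x - h) = f (- x)" if "x \<in> Vec E" "h \<in> Fil E i" for x h
      using ij add_subgroup_uminus[OF Vec_subgroup that(1)] add_subgroup_uminus[OF i that(2)]
      unfolding adapted_def by (metis diff_conv_add_uminus)
    then have "adapted E i j (\<lambda>x. f (- x))"
      using ij unfolding adapted_def by (auto simp: add_subgroup_uminus_iff[OF j])
    then show ?thesis by (rule test_functionsI)
  qed
  \<comment> \<open>The converse direction is needed to see that the reflected measure is still zero
    off the test functions.\<close>
  then have neg_iff: "(\<lambda>x. f (- x)) \<in> test_functions E \<longleftrightarrow> f \<in> test_functions E" for f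
    using neg[of f] neg[of "\<lambda>x. f (- x)"] by auto
  have shift: "\<mu> (\<lambda>x. f (- (x + h))) = \<mu> (\<lambda>x. f (- x))" if "f \<in> test_functions E" "h \<in> Vec E" for f h
    by (rule measure_shift[OF \<mu> neg[OF that(1)] that(2)])
  have "(\<lambda>f. \<mu> (\<lambda>x. f (- x))) = \<mu>"
  proof (rule measure_unique[OF _ \<mu>])
    show "(\<lambda>f. \<mu> (\<lambda>x. f (- x))) \<in> invariant_measures E"
      unfolding invariant_measure_iff
    proof (intro conjI ballI allI impI)
      fix f h assume "f \<in> test_functions E" "h \<in> Vec E"
      then show "\<mu> (\<lambda>x. f (- x + h)) = \<mu> (\<lambda>x. f (- x))"
        using shift[of f "- h"] add_subgroup_uminus[OF Vec_subgroup] by simp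
    qed (simp_all add: measure_add[OF \<mu>] measure_scale[OF \<mu>] measure_outside[OF \<mu>] neg neg_iff)
    show "\<mu> (\<lambda>x. indicator (Fil E i) (- x)) = \<mu> (indicator (Fil E i))" if "i \<in> Idx E" for i
      using add_subgroup_uminus_iff[OF Fil_subgroup[OF that]]
      by (intro arg_cong[where f = \<mu>]) (simp add: indicator_def fun_eq_iff)
  qed
  then show ?thesis by metis
qed

text \<open>Triviality on \<open>Fil E k\<close> makes the integrand a test function. If \<chi> is
  nontrivial on \<open>Fil E i\<close>, translation by some \<open>h\<close> in it multiplies the
  integral by \<open>\<chi> h\<close>, which differs from 1, and also preserves it.\<close>

lemma measure_character:
  assumes \<mu>: "\<mu> \<in> invariant_measures E" and i: "i \<in> Idx E" and k: "k \<in> Idx E"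
    and hom: "\<And>x y. x \<in> Vec E \<Longrightarrow> y \<in> Vec E \<Longrightarrow> \<chi> (x + y) = \<chi> x * \<chi> y"
    and triv: "\<And>x. x \<in> Fil E k \<Longrightarrow> \<chi> x = 1"
  shows "(\<lambda>x. indicator (Fil E i) x * \<chi> x) \<in> test_functions E"
    and "\<mu> (\<lambda>x. indicator (Fil E i) x * \<chi> x) =
      (if \<forall>x\<in>Fil E i. \<chi> x = 1 then \<mu> (indicator (Fil E i)) else 0)"
proof -
  have sub: "add_subgroup (Fil E i)" using i by (rule Fil_subgroup)
  show test: "(\<lambda>x. indicator (Fil E i) x * \<chi> x) \<in> test_functions E"
    using hom triv Fil_subset_Vec[OF k] by (intro test_times[OF test_Fil[OF i] k]) auto
  show "\<mu> (\<lambda>x. indicator (Fil E i) x * \<chi> x) =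
      (if \<forall>x\<in>Fil E i. \<chi> x = 1 then \<mu> (indicator (Fil E i)) else 0)"
  proof (cases "\<forall>x\<in>Fil E i. \<chi> x = 1")
    case True
    then have "(\<lambda>x. indicator (Fil E i) x * \<chi> x) = indicator (Fil E i)"
      by (auto simp: indicator_def)
    with True show ?thesis by simp
  next
    case False
    then obtain h where h: "h \<in> Fil E i" "\<chi> h \<noteq> 1" by blast
    have "\<mu> (\<lambda>x. indicator (Fil E i) (x + h) * \<chi> (x + h)) = \<mu> (\<lambda>x. indicator (Fil E i) x * \<chi> x)"
      using measure_shift[OF \<mu> test, of h] h(1) Fil_subset_Vec[OF i] by blast
    also have "(\<lambda>x. indicator (Fil E i) (x + h) * \<chi> (x + h)) =
        (\<lambda>x. \<chi> h * (indicator (Fil E i) x * \<chi> x))"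
      using h(1) Fil_subset_Vec[OF i] hom[of _ h] add_subgroup_add_iff[OF sub h(1)]
      by (auto simp: indicator_def fun_eq_iff subset_iff)
    finally have "\<chi> h * \<mu> (\<lambda>x. indicator (Fil E i) x * \<chi> x) = \<mu> (\<lambda>x. indicator (Fil E i) x * \<chi> x)"
      by (simp add: measure_scale[OF \<mu> test])
    with h(2) have "\<mu> (\<lambda>x. indicator (Fil E i) x * \<chi> x) = 0" by simp
    with False show ?thesis by presburger
  qed
qed

end

section \<open>Duality\<close>

text \<open>This turns finite dimension of the quotients into finite index. Each new generator adds
  one translate of the previous span for every scalar.\<close>

lemma finite_span:
  fixes s :: "'k::{field, finite} \<Rightarrow> 'v::ab_group_add \<Rightarrow> 'v"
  assumes "vector_space s" "finite S"
  shows "finite (module.span s S)"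
proof -
  interpret vector_space s by fact
  show ?thesis
    using assms(2)
  proof (induction rule: finite_induct)
    case (insert a S)
    have "x \<in> (\<lambda>(k, y). y + s k a) ` (UNIV \<times> span S)" if x: "x \<in> span (insert a S)" for x
    proof -
      obtain k where "x - s k a \<in> span S" using x unfolding span_insert by blast
      then show ?thesis by (intro image_eqI[of _ _ "(k, x - s k a)"]) auto
    qed
    then have "span (insert a S) \<subseteq> (\<lambda>(k, y). y + s k a) ` (UNIV \<times> span S)" by blast
    moreover have "finite ((\<lambda>(k, y). y + s k a) ` (UNIV \<times> span S))"
      using insert.IH by simp
    ultimately show ?case by (rule finite_subset)
  qed simp
qed

text \<open>Closure under scalars is what allows passing from triviality of the character on the
  values of a functional to vanishing of the functional.\<close>

locale filtered_module = filtered_group E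
  for E :: "('k::{field, finite}, 'v::ab_group_add, 'i) filtered" +
  assumes Fil_scale: "i \<in> Idx E \<Longrightarrow> x \<in> Fil E i \<Longrightarrow> Scale E c x \<in> Fil E i"

lemma filtered_spaceD:
  assumes "filtered_space E"
  shows "vector_space (Scale E)" and "module.subspace (Scale E) (Vec E)"
    and "partial_order_on (Idx E) (Ord E)"
    and "\<forall>i\<in>Idx E. \<forall>j\<in>Idx E. \<exists>k\<in>Idx E. \<exists>l\<in>Idx E.
        (k, i) \<in> Ord E \<and> (i, l) \<in> Ord E \<and> (k, j) \<in> Ord E \<and> (j, l) \<in> Ord E"
    and "\<forall>i\<in>Idx E. module.subspace (Scale E) (Fil E i) \<and> Fil E i \<subseteq> Vec E"
    and "\<forall>(i, j)\<in>Ord E. Fil E i \<subseteq> Fil E j"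
    and "(\<Union>i\<in>Idx E. Fil E i) = Vec E"
  using assms unfolding filtered_space_def by - (elim conjE, assumption)+

lemma C1_filtered_module:
  fixes E :: "('k::{field, finite}, 'v::ab_group_add, 'i) filtered"
  assumes "C1_space E"
  shows "filtered_module E"
proof -
  have fil: "filtered_space E"
    and C1: "\<forall>(i, j)\<in>Ord E. quot_finite_dim (Scale E) (Fil E j) (Fil E i)"
    using assms by (auto simp: C1_space_def)
  note vs = filtered_spaceD(1)[OF fil] and vsub = filtered_spaceD(2)[OF fil]
    and po = filtered_spaceD(3)[OF fil] and dir = filtered_spaceD(4)[OF fil]
    and mono = filtered_spaceD(6)[OF fil] and UN = filtered_spaceD(7)[OF fil]
  have sub: "module.subspace (Scale E) (Fil E i)" if "i \<in> Idx E" for i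
    using filtered_spaceD(5)[OF fil] that by blast
  interpret vector_space "Scale E" by fact
  show ?thesis
  proof unfold_locales
    show "Idx E \<noteq> {}" using UN subspace_0[OF vsub] by blast
    show "i \<in> Idx E \<and> j \<in> Idx E" if "(i, j) \<in> Ord E" for i j
      using po that by (auto simp: partial_order_on_def preorder_on_def)
    show "(i, i) \<in> Ord E" if "i \<in> Idx E" for i
      using po that by (auto simp: partial_order_on_def preorder_on_def refl_on_def)
    show "(i, k) \<in> Ord E" if "(i, j) \<in> Ord E" "(j, k) \<in> Ord E" for i j k
      using po that unfolding partial_order_on_def preorder_on_def by (meson transD)
    show "add_subgroup (Fil E i)" if "i \<in> Idx E" for i
      using sub[OF that] by (simp add: add_subgroup_def subspace_0 subspace_diff)
    show "Scale E c x \<in> Fil E i" if "i \<in> Idx E" "x \<in> Fil E i" for i c x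
      using sub[OF that(1)] that(2) by (rule subspace_scale)
    show "finite (quot (Fil E j) (Fil E i))" if "(i, j) \<in> Ord E" for i j
    proof -
      have "quot_finite_dim (Scale E) (Fil E j) (Fil E i)" using C1 that by auto
      then obtain S where "finite S"
        and S: "\<forall>C\<in>quot (Fil E j) (Fil E i). \<exists>x\<in>span S. C = x +o Fil E i"
        unfolding quot_finite_dim_def by blast
      then have "quot (Fil E j) (Fil E i) \<subseteq> (\<lambda>x. x +o Fil E i) ` span S" by blast
      then show ?thesis
        using finite_span[OF vs \<open>finite S\<close>] by (meson finite_imageI finite_subset)
    qed
    show "\<exists>k l. (k, i) \<in> Ord E \<and> (i, l) \<in> Ord E \<and> (k, j) \<in> Ord E \<and> (j, l) \<in> Ord E"
      if "i \<in> Idx E" "j \<in> Idx E" for i j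
      using dir[rule_format, OF that] by blast
    show "Fil E i \<subseteq> Fil E j" if "(i, j) \<in> Ord E" for i j
      using mono that by auto
  qed (rule UN)
qed

text \<open>A basis of \<open>Fil E i\<close> stays independent when \<open>x\<close> is added, so a
  linear map can be prescribed as 1 at \<open>x\<close> and 0 on the basis.\<close>

lemma separation:
  fixes E :: "('k::field, 'v::ab_group_add, 'i) filtered"
  assumes "filtered_space E" "i \<in> Idx E" "x \<in> Vec E" "x \<notin> Fil E i"
  shows "\<exists>u\<in>annihilator E i. u x = 1"
proof -
  have vs: "vector_space (Scale E)" and sub: "module.subspace (Scale E) (Fil E i)"
    and subV: "module.subspace (Scale E) (Vec E)" and V: "Fil E i \<subseteq> Vec E"
    using filtered_spaceD[OF assms(1)] assms(2) by blast+
  interpret vector_space_pair "Scale E" "(*) :: 'k \<Rightarrow> 'k \<Rightarrow> 'k"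
    using vs unfolding vector_space_pair_def
    by (simp add: vector_space_def algebra_simps)
  obtain B where B: "B \<subseteq> Fil E i" "vs1.independent B" "Fil E i \<subseteq> vs1.span B"
    by (rule vs1.maximal_independent_subset)
  have "vs1.span B \<subseteq> Fil E i" using vs1.span_minimal[OF B(1) sub] .
  then have "x \<notin> vs1.span B" using assms(4) by blast
  then have "vs1.independent (insert x B)" "x \<notin> B"
    using B(2) vs1.independent_insertI vs1.span_base by blast+
  then obtain g where g: "Vector_Spaces.linear (Scale E) (*) g" "\<forall>b\<in>insert x B. g b = (if b = x then 1 else 0)"
    using linear_independent_extend[of "insert x B" "\<lambda>b. if b = x then 1 else 0"] by blast
  interpret g: Vector_Spaces.linear "Scale E" "(*)" g by fact
  have g0: "g y = 0" if "y \<in> Fil E i" for y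
  proof (rule linear_eq_0_on_span[OF g(1)])
    show "y \<in> vs1.span B" using that B(3) by blast
  qed (use g(2) \<open>x \<notin> B\<close> in auto)
  \<comment> \<open>The extension \<open>g\<close> is linear on the whole type; it is cut off to the
    representation by zero outside \<open>Vec E\<close>.\<close>
  have "(\<lambda>y. if y \<in> Vec E then g y else 0) \<in> annihilator E i"
    using g0 V vs1.subspace_add[OF subV] vs1.subspace_scale[OF subV]
    by (auto simp: annihilator_def functionals_def linear_on_def g.add g.scale)
  then show ?thesis using assms(3) g(2) by (intro bexI) auto
qed

lemma annihilator_subgroup: "add_subgroup (annihilator E i)"
  unfolding add_subgroup_def annihilator_def functionals_def linear_on_def
  by (auto simp: algebra_simps)

lemma annihilator_scale: "u \<in> annihilator E i \<Longrightarrow> pointwise_scale c u \<in> annihilator E i"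
  unfolding annihilator_def functionals_def linear_on_def pointwise_scale_def
  by (auto simp: algebra_simps)

lemma dual_sel [simp]:
  "Idx (dual E) = Idx E" "Ord (dual E) = (Ord E)\<inverse>" "Fil (dual E) = annihilator E"
  "Scale (dual E) = pointwise_scale"
  by (simp_all add: dual_def)

lemma Vec_dual: "Vec (dual E) = (\<Union>i\<in>Idx E. annihilator E i)"
  by (simp add: dual_def)

lemma annihilator_antimono: "Fil E i \<subseteq> Fil E j \<Longrightarrow> annihilator E j \<subseteq> annihilator E i"
  by (auto simp: annihilator_def)

lemma annihilator_subset_dual: "i \<in> Idx E \<Longrightarrow> annihilator E i \<subseteq> Vec (dual E)"
  by (auto simp: Vec_dual)

lemma Vec_dual_functional: "w \<in> Vec (dual E) \<Longrightarrow> w \<in> functionals (Scale E) (Vec E)"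
  by (auto simp: Vec_dual annihilator_def)

lemma functional_add: "w \<in> functionals s V \<Longrightarrow> x \<in> V \<Longrightarrow> y \<in> V \<Longrightarrow> w (x + y) = w x + w y"
  and functional_scale: "w \<in> functionals s V \<Longrightarrow> x \<in> V \<Longrightarrow> w (s c x) = c * w x"
  by (auto simp: functionals_def linear_on_def)

section \<open>Additive characters and orthogonality for the pairing with the dual\<close>

locale character =
  fixes \<psi> :: "'k::{field, finite} \<Rightarrow> complex"
  assumes nontrivial: "nontrivial_character \<psi>"
begin

lemma \<psi>_add: "\<psi> (a + b) = \<psi> a * \<psi> b"
  using nontrivial by (simp add: nontrivial_character_def)

lemma \<psi>_zero [simp]: "\<psi> 0 = 1"
  using nontrivial \<psi>_add[of 0 0] by (simp add: nontrivial_character_def)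

text \<open>The multiples of a nonzero \<open>a\<close> fill the field, and a value other than 1 at
  \<open>b\<close> is reached with \<open>c = b / a\<close>.\<close>

lemma trivial_iff: "(\<forall>c. \<psi> (c * a) = 1) \<longleftrightarrow> a = 0"
proof
  assume *: "\<forall>c. \<psi> (c * a) = 1"
  obtain b where "\<psi> b \<noteq> 1" using nontrivial by (auto simp: nontrivial_character_def)
  then show "a = 0" using *[rule_format, of "b / a"] by (cases "a = 0") auto
qed simp

end

lemma (in filtered_module) trivial_on_Fil_iff:
  assumes \<psi>: "character \<psi>" and w: "w \<in> functionals (Scale E) (Vec E)" and i: "i \<in> Idx E"
  shows "(\<forall>x\<in>Fil E i. \<psi> (w x) = 1) \<longleftrightarrow> w \<in> annihilator E i"
proof
  assume *: "\<forall>x\<in>Fil E i. \<psi> (w x) = 1"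
  have "w x = 0" if x: "x \<in> Fil E i" for x
  proof -
    have "\<psi> (c * w x) = 1" for c
      using *[rule_format, OF Fil_scale[OF i x, of c]] functional_scale[OF w] x Fil_subset_Vec[OF i]
      by auto
    then show ?thesis using character.trivial_iff[OF \<psi>] by blast
  qed
  with w show "w \<in> annihilator E i" by (simp add: annihilator_def)
qed (simp add: annihilator_def character.\<psi>_zero[OF \<psi>])

text \<open>The inner sum is a character sum: it counts \<open>A'/B'\<close> when \<open>C\<close>
  is the trivial coset and vanishes otherwise by nondegeneracy. The kernel is left abstract so that
  the space and its dual can exchange roles.\<close>

lemma pairing_sum:
  fixes K :: "'v::ab_group_add \<Rightarrow> 'w::ab_group_add \<Rightarrow> complex"
  assumes A: "add_subgroup A" and B: "add_subgroup B" and BA: "B \<subseteq> A"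
    and A': "add_subgroup A'" and B': "add_subgroup B'" and BA': "B' \<subseteq> A'"
    and fin: "finite (quot A B)"
    and hom: "\<And>x u v. x \<in> A \<Longrightarrow> u \<in> A' \<Longrightarrow> v \<in> A' \<Longrightarrow> K x (u + v) = K x u * K x v"
    and triv: "\<And>x u. x \<in> A \<Longrightarrow> u \<in> B' \<Longrightarrow> K x u = 1"
    and nondeg: "\<And>x. x \<in> A \<Longrightarrow> (\<forall>u\<in>A'. K x u = 1) \<longleftrightarrow> x \<in> B"
  shows "(\<Sum>C\<in>quot A B. \<Sum>D\<in>quot A' B'. K (rep C) (rep D)) = of_nat (card (quot A' B'))"
proof -
  have "(\<Sum>D\<in>quot A' B'. K (rep C) (rep D)) =
      (if C = B then of_nat (card (quot A' B')) else 0 :: complex)"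
    if C: "C \<in> quot A B" for C
  proof (cases "C = B")
    case True
    then have "rep C \<in> B" using rep_coset[OF B, of 0] by simp
    then have "K (rep C) u = 1" if "u \<in> A'" for u using nondeg BA that by blast
    then show ?thesis using True rep_mem[OF B' A' BA'] by simp
  next
    case False
    then have "rep C \<notin> B" using coset_rep[OF B C] coset_eq_self_iff[OF B] by metis
    then obtain h where h: "h \<in> A'" "K (rep C) h \<noteq> 1"
      using nondeg rep_mem[OF B A BA C] by blast
    have "coset_sum A' B' (K (rep C)) = 0"
      using rep_mem[OF B A BA C] hom triv by (intro coset_sum_character[OF A' B' BA', where \<chi> = "K (rep C)", OF _ _ h]) auto
    then show ?thesis using False by (simp add: coset_sum_def)
  qed
  moreover have "B \<in> quot A B"
    unfolding quot_def using add_subgroup_0[OF A] by (intro image_eqI[of _ _ 0]) simp_all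
  ultimately show ?thesis using fin by simp
qed

text \<open>Summing \<open>\<psi> (u x)\<close> over \<open>A/B \<times> A\<^sup>\<bottom>/B\<^sup>\<bottom>\<close> in both orders.\<close>

lemma card_quot_annihilator:
  fixes E :: "('k::{field, finite}, 'v::ab_group_add, 'i) filtered" and \<psi> :: "'k \<Rightarrow> complex"
  assumes \<psi>: "character \<psi>" and C1: "C1_space E" and ij: "(i, j) \<in> Ord E"
  shows "finite (quot (annihilator E i) (annihilator E j))"
    and "card (quot (annihilator E i) (annihilator E j)) = card (quot (Fil E j) (Fil E i))"
proof -
  interpret filtered_module E using C1 by (rule C1_filtered_module)
  interpret character \<psi> by fact
  have fil: "filtered_space E" using C1 by (simp add: C1_space_def)
  have i: "i \<in> Idx E" and j: "j \<in> Idx E" using Ord_Idx[OF ij] by auto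
  define A where "A = Fil E j"
  define B where "B = Fil E i"
  define A' where "A' = annihilator E i"
  define B' where "B' = annihilator E j"
  have AV: "A \<subseteq> Vec E" unfolding A_def using j by (rule Fil_subset_Vec)
  have BA: "B \<subseteq> A" unfolding A_def B_def using ij by (rule Fil_mono)
  have BA': "B' \<subseteq> A'" unfolding A'_def B'_def
    using Fil_mono[OF ij] by (rule annihilator_antimono)
  have A: "add_subgroup A" and B: "add_subgroup B"
    unfolding A_def B_def using Fil_subgroup i j by auto
  have A': "add_subgroup A'" and B': "add_subgroup B'"
    unfolding A'_def B'_def by (rule annihilator_subgroup)+
  have lin: "u \<in> functionals (Scale E) (Vec E)" if "u \<in> A'" for u
    using that unfolding A'_def annihilator_def by blast
  have fin: "finite (quot A B)" unfolding A_def B_def using ij by (rule finite_index)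
  \<comment> \<open>Finiteness on the dual side: a class is determined by the values of a
    representative at finitely many points, and these values lie in a finite field.\<close>
  have inj: "inj_on (\<lambda>D. restrict (rep D) (rep ` quot A B)) (quot A' B')"
  proof (rule inj_onI)
    fix D D' assume D: "D \<in> quot A' B'" "D' \<in> quot A' B'"
      and eq: "restrict (rep D) (rep ` quot A B) = restrict (rep D') (rep ` quot A B)"
    have mem: "rep D \<in> A'" "rep D' \<in> A'" using D rep_mem[OF B' A' BA'] by auto
    \<comment> \<open>Elements of \<open>A'\<close> vanish on \<open>B\<close>, so they are constant
      on its cosets.\<close>
    have val: "u (rep (x +o B)) = u x" if u: "u \<in> A'" and x: "x \<in> A" for u x
    proof -
      have "rep (x +o B) - x \<in> B" by (rule rep_coset[OF B])
      then have "u (x + (rep (x +o B) - x)) = u x + 0"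
        using functional_add[OF lin[OF u], of x "rep (x +o B) - x"] u x AV BA
        unfolding A'_def B_def annihilator_def by auto
      then show ?thesis by simp
    qed
    have "rep D x = rep D' x" if x: "x \<in> A" for x
    proof -
      have "x +o B \<in> quot A B" using x by (auto simp: quot_def)
      then have "rep D (rep (x +o B)) = rep D' (rep (x +o B))"
        using eq by (metis imageI restrict_apply')
      then show ?thesis unfolding val[OF mem(1) x] val[OF mem(2) x] .
    qed
    then have "rep D - rep D' \<in> B'"
      using add_subgroup_diff[OF A' mem] unfolding A'_def B'_def A_def annihilator_def by simp
    then show "D = D'"
      using coset_rep[OF B'] coset_eq_iff[OF B'] D by metis
  qed
  have "finite ((\<lambda>D. restrict (rep D) (rep ` quot A B)) ` quot A' B')"
    by (rule finite_subset[of _ "rep ` quot A B \<rightarrow>\<^sub>E UNIV"])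
      (auto intro!: finite_PiE finite_imageI fin)
  then show fin': "finite (quot (annihilator E i) (annihilator E j))"
    using inj unfolding A'_def B'_def by (rule finite_imageD)
  have nondeg: "(\<forall>u\<in>A'. \<psi> (u x) = 1) \<longleftrightarrow> x \<in> B" if x: "x \<in> A" for x
  proof
    assume *: "\<forall>u\<in>A'. \<psi> (u x) = 1"
    show "x \<in> B"
    proof (rule ccontr)
      assume "x \<notin> B"
      then obtain u where u: "u \<in> A'" "u x = 1"
        using separation[OF fil i] x AV unfolding A'_def B_def by blast
      have "\<psi> (c * 1) = 1" for c
        using * annihilator_scale u unfolding A'_def by (metis pointwise_scale_def)
      then show False using trivial_iff[of 1] by simp
    qed
  next
    assume "x \<in> B" then show "\<forall>u\<in>A'. \<psi> (u x) = 1"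
      unfolding A'_def B_def annihilator_def by simp
  qed
  have nondeg': "(\<forall>x\<in>A. \<psi> (u x) = 1) \<longleftrightarrow> u \<in> B'" if "u \<in> A'" for u
    unfolding A_def B'_def using \<psi> lin[OF that] j by (rule trivial_on_Fil_iff)
  have "(\<Sum>C\<in>quot A B. \<Sum>D\<in>quot A' B'. \<psi> (rep D (rep C))) = of_nat (card (quot A' B'))"
    by (rule pairing_sum[OF A B BA A' B' BA' fin _ _ nondeg])
      (use AV in \<open>auto simp: \<psi>_add B'_def A_def annihilator_def\<close>)
  moreover have "\<psi> (u (x + y)) = \<psi> (u x) * \<psi> (u y)" if "u \<in> A'" "x \<in> A" "y \<in> A" for u x y
    using functional_add[OF lin[OF that(1)] subsetD[OF AV that(2)] subsetD[OF AV that(3)]]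
    by (simp add: \<psi>_add)
  \<comment> \<open>The same lemma with space and annihilators exchanged; the double sum then counts
    the other quotient.\<close>
  then have "(\<Sum>D\<in>quot A' B'. \<Sum>C\<in>quot A B. \<psi> (rep D (rep C))) = of_nat (card (quot A B))"
    by (rule pairing_sum[OF A' B' BA' A B BA fin'[folded A'_def B'_def] _ _ nondeg'])
      (auto simp: A'_def B_def annihilator_def)
  moreover have "(\<Sum>C\<in>quot A B. \<Sum>D\<in>quot A' B'. \<psi> (rep D (rep C))) =
      (\<Sum>D\<in>quot A' B'. \<Sum>C\<in>quot A B. \<psi> (rep D (rep C)))"
    by (rule sum.swap)
  ultimately have "(of_nat (card (quot A' B')) :: complex) = of_nat (card (quot A B))"
    by argo
  then show "card (quot (annihilator E i) (annihilator E j)) = card (quot (Fil E j) (Fil E i))"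
    unfolding A_def B_def A'_def B'_def by simp
qed

lemma dual_filtered_module:
  fixes E :: "('k::{field, finite}, 'v::ab_group_add, 'i) filtered" and \<psi> :: "'k \<Rightarrow> complex"
  assumes \<psi>: "character \<psi>" and C1: "C1_space E"
  shows "filtered_module (dual E)"
proof -
  interpret filtered_module E using C1 by (rule C1_filtered_module)
  show ?thesis
  proof unfold_locales
    show "\<exists>k l. (k, i) \<in> Ord (dual E) \<and> (i, l) \<in> Ord (dual E) \<and>
        (k, j) \<in> Ord (dual E) \<and> (j, l) \<in> Ord (dual E)"
      if "i \<in> Idx (dual E)" "j \<in> Idx (dual E)" for i j
      using directed[of i j] that by auto
  qed (use Idx_nonempty Ord_Idx Ord_refl Ord_trans card_quot_annihilator(1)[OF \<psi> C1]
      in \<open>auto simp: Vec_dual annihilator_subgroup annihilator_scale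
        dest: annihilator_antimono[OF Fil_mono]\<close>)
qed

lemma measure_inverse:
  fixes E :: "('k::{field, finite}, 'v::ab_group_add, 'i) filtered" and \<psi> :: "'k \<Rightarrow> complex"
  assumes \<psi>: "character \<psi>" and C1: "C1_space E" and \<mu>: "\<mu> \<in> invariant_measures E" "\<mu> \<noteq> 0"
  shows "measure_inverse E \<mu> \<in> invariant_measures (dual E)"
    and "i \<in> Idx E \<Longrightarrow>
      measure_inverse E \<mu> (indicator (annihilator E i)) = inverse (\<mu> (indicator (Fil E i)))"
proof -
  interpret filtered_module E using C1 by (rule C1_filtered_module)
  interpret dual: filtered_module "dual E" using \<psi> C1 by (rule dual_filtered_module)
  have "\<exists>\<nu>\<in>invariant_measures (dual E). \<forall>i\<in>Idx (dual E).
      \<nu> (indicator (Fil (dual E) i)) = inverse (\<mu> (indicator (Fil E i)))"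
  proof (rule dual.measure_exists)
    fix j i assume "(j, i) \<in> Ord (dual E)"
    then have ij: "(i, j) \<in> Ord E" by simp
    \<comment> \<open>Positivity lets the index cancel when the relation of
      \<open>measure_Fil\<close> is inverted.\<close>
    then have "card (quot (Fil E j) (Fil E i)) > 0"
      using finite_index Fil_subgroup Ord_Idx card_quot_pos by blast
    then show "inverse (\<mu> (indicator (Fil E i))) =
        of_nat (card (quot (Fil (dual E) i) (Fil (dual E) j))) * inverse (\<mu> (indicator (Fil E j)))"
      using measure_Fil[OF \<mu>(1) ij] by (simp add: card_quot_annihilator(2)[OF \<psi> C1 ij])
  qed
  then have "\<exists>!\<nu>. \<nu> \<in> invariant_measures (dual E) \<and>
      (\<forall>i\<in>Idx E. \<nu> (indicator (annihilator E i)) = inverse (\<mu> (indicator (Fil E i))))"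
    by (auto intro: dual.measure_unique)
  from theI'[OF this] have "measure_inverse E \<mu> \<in> invariant_measures (dual E) \<and> (\<forall>i\<in>Idx E.
      measure_inverse E \<mu> (indicator (annihilator E i)) = inverse (\<mu> (indicator (Fil E i))))"
    unfolding measure_inverse_def .
  then show "measure_inverse E \<mu> \<in> invariant_measures (dual E)"
    and "i \<in> Idx E \<Longrightarrow>
      measure_inverse E \<mu> (indicator (annihilator E i)) = inverse (\<mu> (indicator (Fil E i)))"
    by auto
qed


section \<open>The Fourier transform\<close>

context filtered_module
begin

context
  fixes \<psi> :: "'k \<Rightarrow> complex" and \<mu> :: "('v \<Rightarrow> complex) \<Rightarrow> complex"
  assumes \<psi>: "character \<psi>" and \<mu>: "\<mu> \<in> invariant_measures E"
begin

interpretation character \<psi> by (fact \<psi>)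

lemma character_functional_add:
  assumes "w \<in> Vec (dual E)" "x \<in> Vec E" "y \<in> Vec E"
  shows "cnj (\<psi> (w (x + y))) = cnj (\<psi> (w x)) * cnj (\<psi> (w y))"
  by (simp add: functional_add[OF Vec_dual_functional[OF assms(1)] assms(2,3)] \<psi>_add)

text \<open>A functional in the dual annihilates some \<open>Fil E k\<close>, so its character is
  invariant under that subgroup.\<close>

lemma fourier_integrand_test:
  assumes f: "f \<in> test_functions E" and w: "w \<in> Vec (dual E)"
  shows "(\<lambda>v. f v * cnj (\<psi> (w v))) \<in> test_functions E"
proof -
  obtain k where k: "k \<in> Idx E" "w \<in> annihilator E k" using w by (auto simp: Vec_dual)
  have "cnj (\<psi> (w (x + h))) = cnj (\<psi> (w x))" if "x \<in> Vec E" "h \<in> Fil E k" for x h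
  proof -
    have "h \<in> Vec E" "w h = 0" using that k Fil_subset_Vec[of k] by (auto simp: annihilator_def)
    then show ?thesis using character_functional_add[OF w that(1)] by simp
  qed
  then show ?thesis by (rule test_times[OF f k(1)])
qed

lemma fourier_add:
  assumes "f \<in> test_functions E" "g \<in> test_functions E"
  shows "fourier \<psi> E \<mu> (\<lambda>x. f x + g x) = (\<lambda>w. fourier \<psi> E \<mu> f w + fourier \<psi> E \<mu> g w)"
  using measure_add[OF \<mu> fourier_integrand_test[OF assms(1)] fourier_integrand_test[OF assms(2)]]
  by (auto simp: fourier_def fun_eq_iff distrib_right)

lemma fourier_scale:
  assumes "f \<in> test_functions E"
  shows "fourier \<psi> E \<mu> (\<lambda>x. c * f x) = (\<lambda>w. c * fourier \<psi> E \<mu> f w)"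
  using measure_scale[OF \<mu> fourier_integrand_test[OF assms]]
  by (auto simp: fourier_def fun_eq_iff mult.assoc)

lemma measure_Fil_character:
  assumes i: "i \<in> Idx E" and w: "w \<in> Vec (dual E)"
  shows "(\<lambda>v. indicator (Fil E i) v * cnj (\<psi> (w v))) \<in> test_functions E"
    and "\<mu> (\<lambda>v. indicator (Fil E i) v * cnj (\<psi> (w v))) =
      indicator (annihilator E i) w * \<mu> (indicator (Fil E i))"
proof -
  obtain k where k: "k \<in> Idx E" "w \<in> annihilator E k" using w by (auto simp: Vec_dual)
  have triv: "cnj (\<psi> (w x)) = 1" if "x \<in> Fil E k" for x
    using k(2) that by (simp add: annihilator_def)
  note char = measure_character[OF \<mu> i k(1), where \<chi> = "\<lambda>v. cnj (\<psi> (w v))",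
      OF character_functional_add[OF w] triv]
  show "(\<lambda>v. indicator (Fil E i) v * cnj (\<psi> (w v))) \<in> test_functions E" by (rule char(1))
  show "\<mu> (\<lambda>v. indicator (Fil E i) v * cnj (\<psi> (w v))) =
      indicator (annihilator E i) w * \<mu> (indicator (Fil E i))"
    using char(2) trivial_on_Fil_iff[OF \<psi> Vec_dual_functional[OF w] i]
    by (cases "w \<in> annihilator E i") simp_all
qed

lemma fourier_coset:
  assumes x: "x \<in> Vec E" and i: "i \<in> Idx E"
  shows "fourier \<psi> E \<mu> (indicator (x +o Fil E i)) =
    (\<lambda>w. \<mu> (indicator (Fil E i)) * (indicator (annihilator E i) w * cnj (\<psi> (w x))))"
proof
  fix w
  show "fourier \<psi> E \<mu> (indicator (x +o Fil E i)) w =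
      \<mu> (indicator (Fil E i)) * (indicator (annihilator E i) w * cnj (\<psi> (w x)))"
  proof (cases "w \<in> Vec (dual E)")
    case True
    \<comment> \<open>Substituting \<open>v + x\<close> for \<open>v\<close> moves the coset to the
      subgroup and splits off the constant factor \<open>cnj (\<psi> (w x))\<close>.\<close>
    have "\<mu> (\<lambda>v. indicator (x +o Fil E i) v * cnj (\<psi> (w v))) =
        \<mu> (\<lambda>v. indicator (x +o Fil E i) (v + x) * cnj (\<psi> (w (v + x))))"
      using measure_shift[OF \<mu> fourier_integrand_test[OF test_coset[OF x i] True] x] by simp
    also have "(\<lambda>v. indicator (x +o Fil E i) (v + x) * cnj (\<psi> (w (v + x)))) =
        (\<lambda>v. cnj (\<psi> (w x)) * (indicator (Fil E i) v * cnj (\<psi> (w v))))"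
    proof
      fix v show "indicator (x +o Fil E i) (v + x) * cnj (\<psi> (w (v + x))) =
        cnj (\<psi> (w x)) * (indicator (Fil E i) v * cnj (\<psi> (w v)))"
        using character_functional_add[OF True _ x, of v] Fil_subset_Vec[OF i]
        by (cases "v \<in> Fil E i") (auto simp: indicator_def simp flip: set_minus_plus)
    qed
    also have "\<mu> \<dots> = cnj (\<psi> (w x)) * (indicator (annihilator E i) w * \<mu> (indicator (Fil E i)))"
      by (simp add: measure_scale[OF \<mu> measure_Fil_character(1)[OF i True]]
          measure_Fil_character(2)[OF i True])
    finally show ?thesis using True by (simp add: fourier_def)
  next
    case False
    then have "w \<notin> annihilator E i" using annihilator_subset_dual[OF i] by blast
    with False show ?thesis by (simp add: fourier_def)
  qed
qed

end

end

text \<open>The double annihilator gives back the subgroup, by \<open>separation\<close>. Besides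
  inversion, this detects whether \<open>\<beta> x\<close> lies in \<open>F3 i\<close> in the proof
  of \<open>poisson\<close>.\<close>

lemma bidual_map_annihilator_iff:
  fixes E :: "('k::{field, finite}, 'v::ab_group_add, 'i) filtered" and \<psi> :: "'k \<Rightarrow> complex"
  assumes \<psi>: "character \<psi>" and C1: "C1_space E" and i: "i \<in> Idx E" and v: "v \<in> Vec E"
  shows "bidual_map E v \<in> annihilator (dual E) i \<longleftrightarrow> v \<in> Fil E i"
proof -
  interpret dual: filtered_module "dual E" using \<psi> C1 by (rule dual_filtered_module)
  have scale: "pointwise_scale c w \<in> Vec (dual E)" if "w \<in> Vec (dual E)" for c w
    using that by (auto simp: Vec_dual intro: annihilator_scale)
  have "bidual_map E v \<in> functionals (Scale (dual E)) (Vec (dual E))"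
    unfolding functionals_def linear_on_def
  proof (intro CollectI conjI ballI allI impI)
    show "bidual_map E v (x + y) = bidual_map E v x + bidual_map E v y"
      if "x \<in> Vec (dual E)" "y \<in> Vec (dual E)" for x y
      using that dual.Vec_add[OF that] by (simp add: bidual_map_def)
    show "bidual_map E v (Scale (dual E) c x) = c * bidual_map E v x" if "x \<in> Vec (dual E)" for c x
      using that scale[OF that] by (simp add: bidual_map_def) (simp add: pointwise_scale_def)
  qed (simp add: bidual_map_def)
  then have "bidual_map E v \<in> annihilator (dual E) i \<longleftrightarrow> (\<forall>u\<in>annihilator E i. u v = 0)"
    using annihilator_subset_dual[OF i] by (auto simp: annihilator_def[of "dual E"] bidual_map_def)
  also have "\<dots> \<longleftrightarrow> v \<in> Fil E i"
  proof
    assume *: "\<forall>u\<in>annihilator E i. u v = 0"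
    show "v \<in> Fil E i"
    proof (rule ccontr)
      assume "v \<notin> Fil E i"
      then obtain u where u: "u \<in> annihilator E i" "u v = 1"
        using separation[OF _ i v] C1 unfolding C1_space_def by blast
      have "u v = 0" by (rule *[rule_format, OF u(1)])
      with u(2) show False by simp
    qed
  qed (simp add: annihilator_def)
  finally show ?thesis .
qed

lemma bidual_map_mem:
  fixes E :: "('k::{field, finite}, 'v::ab_group_add, 'i) filtered" and \<psi> :: "'k \<Rightarrow> complex"
  assumes "character \<psi>" "C1_space E" "v \<in> Vec E"
  shows "bidual_map E v \<in> Vec (dual (dual E))"
proof -
  interpret filtered_module E using assms(2) by (rule C1_filtered_module)
  obtain i where i: "i \<in> Idx E" "v \<in> Fil E i" using assms(3) by (rule Vec_cases)
  then have "bidual_map E v \<in> annihilator (dual E) i"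
    using bidual_map_annihilator_iff[OF assms(1,2) _ assms(3)] by blast
  then show ?thesis using i(1) unfolding Vec_dual[of "dual E"] by auto
qed

text \<open>A coset of an annihilator is sent by \<open>T\<close> to a multiple of a character on
  \<open>Fil E i\<close>. The transform back is the indicator of the opposite coset, and the two
  masses cancel by the choice of \<open>measure_inverse\<close>.\<close>

lemma fourier_inversion:
  fixes E :: "('k::{field, finite}, 'v::ab_group_add, 'i) filtered" and \<psi> :: "'k \<Rightarrow> complex"
  assumes \<psi>: "character \<psi>" and C1: "C1_space E" and \<mu>: "\<mu> \<in> invariant_measures E" "\<mu> \<noteq> 0"
    and g: "g \<in> test_functions (dual E)"
  defines "T \<equiv> \<lambda>g. pullback (Vec E) (bidual_map E) (fourier \<psi> (dual E) (measure_inverse E \<mu>) g)"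
  shows "T g \<in> test_functions E" and "fourier \<psi> E \<mu> (T g) = (\<lambda>w. g (- w))"
proof -
  interpret filtered_module E using C1 by (rule C1_filtered_module)
  interpret dual: filtered_module "dual E" using \<psi> C1 by (rule dual_filtered_module)
  interpret character \<psi> by fact
  note \<nu> = measure_inverse[OF \<psi> C1 \<mu>]
  have "T g \<in> test_functions E \<and> fourier \<psi> E \<mu> (T g) = (\<lambda>w. g (- w))"
    using g
  proof (induction rule: dual.test_function_induct)
    case (coset w0 i)
    then have i: "i \<in> Idx E" by simp
    note test = measure_Fil_character(1)[OF \<psi> \<mu>(1) i coset(1)]
    have T: "T (indicator (w0 +o Fil (dual E) i)) =
        (\<lambda>v. inverse (\<mu> (indicator (Fil E i))) * (indicator (Fil E i) v * cnj (\<psi> (w0 v))))"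
    proof
      fix v show "T (indicator (w0 +o Fil (dual E) i)) v =
        inverse (\<mu> (indicator (Fil E i))) * (indicator (Fil E i) v * cnj (\<psi> (w0 v)))"
      proof (cases "v \<in> Vec E")
        case True
        have "bidual_map E v w0 = w0 v" using coset(1) by (simp add: bidual_map_def)
        moreover have "(indicator (annihilator (dual E) i) (bidual_map E v) :: complex) = indicator (Fil E i) v"
          using bidual_map_annihilator_iff[OF \<psi> C1 i True] by (simp add: indicator_def)
        ultimately show ?thesis
          unfolding T_def dual.fourier_coset[OF \<psi> \<nu>(1) coset] using True i \<nu>(2)
          by (simp add: pullback_def)
      next
        case False
        then have "v \<notin> Fil E i" using Fil_subset_Vec[OF i] by blast
        with False show ?thesis by (simp add: T_def pullback_def)
      qed
    qed
    have "fourier \<psi> E \<mu> (T (indicator (w0 +o Fil (dual E) i))) w = indicator (w0 +o Fil (dual E) i) (- w)"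
      for w
    proof (cases "w \<in> Vec (dual E)")
      case True
      then have w: "w0 + w \<in> Vec (dual E)" using dual.Vec_add coset(1) by blast
      \<comment> \<open>Both characters are conjugated, so they combine to the character of
        \<open>w0 + w\<close> rather than of a difference; this is the origin of the sign in
        \<open>g (- w)\<close>.\<close>
      have "\<mu> (\<lambda>v. indicator (Fil E i) v * cnj (\<psi> (w0 v)) * cnj (\<psi> (w v))) =
          \<mu> (\<lambda>v. indicator (Fil E i) v * cnj (\<psi> ((w0 + w) v)))"
        by (simp add: \<psi>_add mult.assoc)
      also have "\<dots> = indicator (annihilator E i) (w0 + w) * \<mu> (indicator (Fil E i))"
        by (rule measure_Fil_character(2)[OF \<psi> \<mu>(1) i w])
      finally have "fourier \<psi> E \<mu> (T (indicator (w0 +o Fil (dual E) i))) w =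
          indicator (annihilator E i) (w0 + w)"
        unfolding T fourier_scale[OF \<psi> \<mu>(1) test] using True measure_nonzero[OF \<mu> i]
        by (simp add: fourier_def)
      also have "\<dots> = indicator (w0 +o Fil (dual E) i) (- w)"
      proof -
        have "- w - w0 = - (w0 + w)" by simp
        then have "- w \<in> w0 +o annihilator E i \<longleftrightarrow> w0 + w \<in> annihilator E i"
          unfolding set_minus_plus[symmetric]
          by (metis add_subgroup_uminus_iff annihilator_subgroup)
        then show ?thesis by (simp add: indicator_def)
      qed
      finally show ?thesis .
    next
      case False
      \<comment> \<open>The coset lies in \<open>Vec (dual E)\<close>, which is closed under
        negation, so outside it both sides are zero.\<close>
      have "- w \<notin> w0 +o annihilator E i"
      proof
        assume "- w \<in> w0 +o annihilator E i"
        then have "- w - w0 \<in> Vec (dual E)"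
          using annihilator_subset_dual[OF i] by (auto simp flip: set_minus_plus)
        then have "- (- w - w0 + w0) \<in> Vec (dual E)"
          using dual.Vec_add[OF _ coset(1)] add_subgroup_uminus[OF dual.Vec_subgroup] by blast
        with False show False by simp
      qed
      with False show ?thesis by (simp add: fourier_def)
    qed
    moreover have "T (indicator (w0 +o Fil (dual E) i)) \<in> test_functions E"
      unfolding T using test by (rule test_scale)
    ultimately show ?case by blast
  next
    case (scale g c)
    have "T (\<lambda>x. c * g x) = (\<lambda>v. c * T g v)"
      unfolding T_def dual.fourier_scale[OF \<psi> \<nu>(1) scale(1)] by (auto simp: pullback_def)
    then show ?case using scale(2) test_scale fourier_scale[OF \<psi> \<mu>(1)] by simp
  next
    case (add g h)
    have "T (\<lambda>x. g x + h x) = (\<lambda>v. T g v + T h v)"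
      unfolding T_def dual.fourier_add[OF \<psi> \<nu>(1) add(1,2)] by (auto simp: pullback_def)
    then show ?case using add(3,4) test_add fourier_add[OF \<psi> \<mu>(1)] by simp
  qed
  then show "T g \<in> test_functions E" "fourier \<psi> E \<mu> (T g) = (\<lambda>w. g (- w))" by auto
qed


section \<open>Admissible triples\<close>

lemma dominates_Ord:
  assumes "dominates E E'" "(i, j) \<in> Ord E'" "i \<in> Idx E'" "j \<in> Idx E'"
  obtains k l where "(k, l) \<in> Ord E" "Fil E k = Fil E' i" "Fil E l = Fil E' j"
proof -
  obtain \<phi> where "\<forall>(i, j)\<in>Ord E'. (\<phi> i, \<phi> j) \<in> Ord E" "\<forall>i\<in>Idx E'. Fil E (\<phi> i) = Fil E' i"
    using assms(1) unfolding dominates_def by blast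
  with assms(2-4) show thesis by (intro that[of "\<phi> i" "\<phi> j"]) auto
qed

lemma dominates_between:
  assumes "dominates E E'" "filtered_group E" "k \<in> Idx E"
  obtains i j where "i \<in> Idx E'" "j \<in> Idx E'" "Fil E' i \<subseteq> Fil E k" "Fil E k \<subseteq> Fil E' j"
proof -
  obtain \<phi> where "\<forall>i\<in>Idx E'. Fil E (\<phi> i) = Fil E' i"
    and \<phi>: "\<forall>k\<in>Idx E. \<exists>i\<in>Idx E'. \<exists>j\<in>Idx E'. (\<phi> i, k) \<in> Ord E \<and> (k, \<phi> j) \<in> Ord E"
    using assms(1) unfolding dominates_def by blast
  moreover obtain i j where "i \<in> Idx E'" "j \<in> Idx E'" "(\<phi> i, k) \<in> Ord E" "(k, \<phi> j) \<in> Ord E"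
    using \<phi> assms(3) by blast
  ultimately show thesis
    using filtered_group.Fil_mono[OF assms(2)] that[of i j] by metis
qed

text \<open>One inclusion transports the witnesses along the index map; the other encloses each
  filtration subgroup of \<open>E\<close> between two of \<open>E'\<close>.\<close>

lemma dominates_test_functions:
  assumes dom: "dominates E E'" and E: "filtered_group E" and E': "filtered_group E'"
  shows "test_functions E = test_functions E'"
proof (intro equalityI subsetI)
  interpret filtered_group E by fact
  interpret E': filtered_group E' by fact
  have Vec: "Vec E = Vec E'" using dom by (simp add: dominates_def)
  {
    fix f assume "f \<in> test_functions E'"
    then obtain i j where f: "adapted E' i j f" by (auto simp: test_functions_iff)
    obtain k l where "(k, l) \<in> Ord E" "Fil E k = Fil E' i" "Fil E l = Fil E' j"
      using dominates_Ord[OF dom E'.adapted_Ord[OF f]] E'.Ord_Idx[OF E'.adapted_Ord[OF f]] by blast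
    then have "adapted E k l f" using f Vec by (simp add: adapted_def)
    then show "f \<in> test_functions E" by (rule test_functionsI)
  next
    fix f assume "f \<in> test_functions E"
    then obtain k l where f: "adapted E k l f" by (auto simp: test_functions_iff)
    then have kl: "k \<in> Idx E" "l \<in> Idx E" using Ord_Idx adapted_Ord by blast+
    obtain i where i: "i \<in> Idx E'" "Fil E' i \<subseteq> Fil E k" using dominates_between[OF dom E kl(1)] .
    obtain j where j: "j \<in> Idx E'" "Fil E l \<subseteq> Fil E' j" using dominates_between[OF dom E kl(2)] .
    \<comment> \<open>The bounds \<open>i\<close> and \<open>j\<close> need not be comparable;
      \<open>m\<close> is taken below both so that \<open>(m, j)\<close> is an admissible pair of
      indices.\<close>
    obtain m where m: "(m, i) \<in> Ord E'" "(m, j) \<in> Ord E'" using E'.lower i(1) j(1) by blast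
    have "adapted E' m j f"
      using f i(2) j(2) E'.Fil_mono[OF m(1)] m(2) Vec unfolding adapted_def by (auto simp: subset_iff)
    then show "f \<in> test_functions E'" by (rule test_functionsI)
  }
qed

lemma add_subgroup_image:
  fixes f :: "'v::ab_group_add \<Rightarrow> 'w::ab_group_add"
  assumes A: "add_subgroup A" and f: "\<And>x y. x \<in> A \<Longrightarrow> y \<in> A \<Longrightarrow> f (x + y) = f x + f y"
  shows "add_subgroup (f ` A)"
proof -
  have 0: "f 0 = 0" using f[of 0 0] add_subgroup_0[OF A] by simp
  have "f x - f y = f (x - y)" if "x \<in> A" "y \<in> A" for x y
    using f[OF add_subgroup_diff[OF A that] that(2)] by simp
  then have "f x - f y \<in> f ` A" if "x \<in> A" "y \<in> A" for x y
    using that add_subgroup_diff[OF A that] by simp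
  moreover have "0 \<in> f ` A" using 0 add_subgroup_0[OF A] by (intro image_eqI[of _ _ 0]) simp_all
  ultimately show ?thesis by (auto simp: add_subgroup_def)
qed

locale admissible = character \<psi> for \<psi> :: "'k::{field, finite} \<Rightarrow> complex" +
  fixes \<alpha> :: "'v1::ab_group_add \<Rightarrow> 'v2::ab_group_add" and \<beta> :: "'v2 \<Rightarrow> 'v3::ab_group_add"
    and E1 :: "('k, 'v1, 'i1) filtered" and E2 :: "('k, 'v2, 'i2) filtered"
    and E3 :: "('k, 'v3, 'i3) filtered"
    and \<mu>1 :: "('v1 \<Rightarrow> complex) \<Rightarrow> complex" and \<mu>2 :: "('v2 \<Rightarrow> complex) \<Rightarrow> complex"
  assumes triple: "admissible_triple \<alpha> \<beta> E1 E2 E3"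
    and \<mu>1: "\<mu>1 \<in> invariant_measures E1" "\<mu>1 \<noteq> 0"
    and \<mu>2: "\<mu>2 \<in> invariant_measures E2" "\<mu>2 \<noteq> 0"
begin

lemma is_character: "character \<psi>" by unfold_locales

lemma C1: "C1_space E1" "C1_space E2" "C1_space E3"
  using triple unfolding admissible_triple_def by - (elim conjE, assumption)+

sublocale E1: filtered_module E1 using C1(1) by (rule C1_filtered_module)
sublocale E2: filtered_module E2 using C1(2) by (rule C1_filtered_module)
sublocale E3: filtered_module E3 using C1(3) by (rule C1_filtered_module)
sublocale dual3: filtered_module "dual E3" using is_character C1(3) by (rule dual_filtered_module)

abbreviation "F1 i \<equiv> {x \<in> Vec E1. \<alpha> x \<in> Fil E2 i}"
abbreviation "F3 i \<equiv> \<beta> ` Fil E2 i"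

lemma linear_maps:
  "linear_on (Scale E1) (Scale E2) (Vec E1) \<alpha>" "linear_on (Scale E2) (Scale E3) (Vec E2) \<beta>"
  and exact: "short_exact (Vec E1) (Vec E2) (Vec E3) 0 \<alpha> \<beta>"
  using triple unfolding admissible_triple_def by - (elim conjE, assumption)+

lemma dominates: "dominates E1 (sub_filtration \<alpha> E1 E2)" "dominates E3 (quot_filtration \<beta> E2 E3)"
  using triple unfolding admissible_triple_def Let_def by - (elim conjE, assumption)+

lemma exact_quot:
  assumes "(i, j) \<in> Ord E2"
  shows "short_exact (quot (F1 j) (F1 i)) (quot (Fil E2 j) (Fil E2 i)) (quot (F3 j) (F3 i)) (F3 i)
    (quot_map \<alpha> (Fil E2 i)) (quot_map \<beta> (F3 i))"
proof -
  have "\<forall>(i, j)\<in>Ord E2. short_exact (quot (F1 j) (F1 i)) (quot (Fil E2 j) (Fil E2 i))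
      (quot (F3 j) (F3 i)) (F3 i) (quot_map \<alpha> (Fil E2 i)) (quot_map \<beta> (F3 i))"
    using triple unfolding admissible_triple_def Let_def sub_filtration_def quot_filtration_def
    by simp
  then show ?thesis using assms by blast
qed

lemma \<alpha>_add: "x \<in> Vec E1 \<Longrightarrow> y \<in> Vec E1 \<Longrightarrow> \<alpha> (x + y) = \<alpha> x + \<alpha> y"
  and \<beta>_add: "v \<in> Vec E2 \<Longrightarrow> w \<in> Vec E2 \<Longrightarrow> \<beta> (v + w) = \<beta> v + \<beta> w"
  and \<beta>_scale: "v \<in> Vec E2 \<Longrightarrow> \<beta> (Scale E2 c v) = Scale E3 c (\<beta> v)"
  using linear_maps by (auto simp: linear_on_def)

lemma ker_\<beta>: "\<alpha> ` Vec E1 = {y \<in> Vec E2. \<beta> y = 0}"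
  and \<beta>_image: "\<beta> ` Vec E2 = Vec E3"
  using exact unfolding short_exact_def by - (elim conjE, assumption)+

lemma \<alpha>_mem: "x \<in> Vec E1 \<Longrightarrow> \<alpha> x \<in> Vec E2"
  and \<beta>_\<alpha>: "x \<in> Vec E1 \<Longrightarrow> \<beta> (\<alpha> x) = 0"
  using ker_\<beta> by blast+

lemma \<beta>_diff:
  assumes "x \<in> Vec E2" "y \<in> Vec E2"
  shows "\<beta> (x - y) = \<beta> x - \<beta> y"
  using \<beta>_add[of "x - y" y] add_subgroup_diff[OF E2.Vec_subgroup assms] assms(2) by simp

lemma \<alpha>_diff:
  assumes "x \<in> Vec E1" "y \<in> Vec E1"
  shows "\<alpha> (x - y) = \<alpha> x - \<alpha> y"
  using \<alpha>_add[of "x - y" y] add_subgroup_diff[OF E1.Vec_subgroup assms] assms(2) by simp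

text \<open>By domination the groups \<open>F1 i\<close> and \<open>F1 j\<close> belong to the
  filtration of \<open>E1\<close> itself, so the index formula for \<open>\<mu>1\<close> applies to
  them.\<close>

lemma F1_filtration:
  assumes "(i, j) \<in> Ord E2"
  obtains k l where "(k, l) \<in> Ord E1" "Fil E1 k = F1 i" "Fil E1 l = F1 j"
  using dominates_Ord[OF dominates(1), of i j] E2.Ord_Idx[OF assms] assms
  by (auto simp: sub_filtration_def)

lemma F3_filtration:
  assumes "(i, j) \<in> Ord E2"
  obtains k l where "(k, l) \<in> Ord E3" "Fil E3 k = F3 i" "Fil E3 l = F3 j"
  using dominates_Ord[OF dominates(2), of i j] E2.Ord_Idx[OF assms] assms
  by (auto simp: quot_filtration_def)

lemma F1_Fil: "i \<in> Idx E2 \<Longrightarrow> \<exists>k\<in>Idx E1. Fil E1 k = F1 i"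
proof -
  assume "i \<in> Idx E2"
  then have "(i, i) \<in> Ord E2" by (rule E2.Ord_refl)
  then obtain k l where kl: "(k, l) \<in> Ord E1" "Fil E1 k = F1 i" "Fil E1 l = F1 i"
    by (rule F1_filtration)
  show ?thesis using E1.Ord_Idx[OF kl(1)] kl(2) by (intro bexI[of _ k]) simp_all
qed

lemma F3_Fil: "i \<in> Idx E2 \<Longrightarrow> \<exists>k\<in>Idx E3. Fil E3 k = F3 i"
proof -
  assume "i \<in> Idx E2"
  then have "(i, i) \<in> Ord E2" by (rule E2.Ord_refl)
  then obtain k l where kl: "(k, l) \<in> Ord E3" "Fil E3 k = F3 i" "Fil E3 l = F3 i"
    by (rule F3_filtration)
  show ?thesis using E3.Ord_Idx[OF kl(1)] kl(2) by (intro bexI[of _ k]) simp_all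
qed

lemma F3_subgroup: "i \<in> Idx E2 \<Longrightarrow> add_subgroup (F3 i)"
  using E2.Fil_subset_Vec by (intro add_subgroup_image[OF E2.Fil_subgroup] \<beta>_add) auto

text \<open>By exactness of the sequence of quotients, the kernel of the map induced by \<beta> is a
  bijective image of the quotient of \<open>F1 j\<close> by \<open>F1 i\<close>.\<close>

lemma card_quot:
  assumes ij: "(i, j) \<in> Ord E2"
  shows "card (quot (Fil E2 j) (Fil E2 i)) = card (quot (F1 j) (F1 i)) * card (quot (F3 j) (F3 i))"
proof -
  have i: "i \<in> Idx E2" and j: "j \<in> Idx E2" using E2.Ord_Idx[OF ij] by auto
  have jV: "Fil E2 j \<subseteq> Vec E2" using j by (rule E2.Fil_subset_Vec)
  note ex = exact_quot[OF ij, unfolded short_exact_def]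
  \<comment> \<open>Summing the constant 1 turns \<open>sum_quot_map\<close> into a count.\<close>
  have "(\<Sum>C\<in>quot (Fil E2 j) (Fil E2 i). (\<lambda>_. 1) (quot_map \<beta> (F3 i) C)) =
      of_nat (card {C\<in>quot (Fil E2 j) (Fil E2 i). quot_map \<beta> (F3 i) C = F3 i}) *
      (\<Sum>D\<in>quot (F3 j) (F3 i). (1::complex))"
    by (rule sum_quot_map[OF E2.Fil_subgroup[OF j] E2.Fil_subgroup[OF i] E2.Fil_mono[OF ij]
          F3_subgroup[OF i]])
      (use jV \<beta>_add E2.finite_index[OF ij] in auto)
  moreover have "card {C\<in>quot (Fil E2 j) (Fil E2 i). quot_map \<beta> (F3 i) C = F3 i} =
      card (quot (F1 j) (F1 i))"
    using ex card_image[of "quot_map \<alpha> (Fil E2 i)" "quot (F1 j) (F1 i)"] by simp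
  ultimately have "(of_nat (card (quot (Fil E2 j) (Fil E2 i))) :: complex) =
      of_nat (card (quot (F1 j) (F1 i)) * card (quot (F3 j) (F3 i)))"
    by simp
  then show ?thesis by (simp only: of_nat_eq_iff)
qed

text \<open>The values sought for the measure on \<open>E3\<close> are prescribed on the groups
  \<open>F3 i\<close>, so existence has to be applied to the filtration that they form. Finite index
  comes from surjectivity in the exact sequence of quotients.\<close>

sublocale Q: filtered_group "quot_filtration \<beta> E2 E3"
proof unfold_locales
  fix i j assume "(i, j) \<in> Ord (quot_filtration \<beta> E2 E3)"
  then have ij: "(i, j) \<in> Ord E2" by (simp add: quot_filtration_def)
  have "finite (quot_map \<beta> (F3 i) ` quot (Fil E2 j) (Fil E2 i))"
    using E2.finite_index[OF ij] by (rule finite_imageI)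
  then show "finite (quot (Fil (quot_filtration \<beta> E2 E3) j) (Fil (quot_filtration \<beta> E2 E3) i))"
    using exact_quot[OF ij] by (simp add: quot_filtration_def short_exact_def)
  show "Fil (quot_filtration \<beta> E2 E3) i \<subseteq> Fil (quot_filtration \<beta> E2 E3) j"
    using E2.Fil_mono[OF ij] by (auto simp: quot_filtration_def)
  show "i \<in> Idx (quot_filtration \<beta> E2 E3) \<and> j \<in> Idx (quot_filtration \<beta> E2 E3)"
    using E2.Ord_Idx[OF ij] by (simp add: quot_filtration_def)
next
  show "(\<Union>i\<in>Idx (quot_filtration \<beta> E2 E3). Fil (quot_filtration \<beta> E2 E3) i) =
      Vec (quot_filtration \<beta> E2 E3)"
    by (simp add: quot_filtration_def E2.Fil_UN \<beta>_image flip: image_UN)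
qed (use E2.Idx_nonempty E2.Ord_refl E2.Ord_trans E2.directed F3_subgroup
    in \<open>auto simp: quot_filtration_def\<close>)

text \<open>Invariant measures depend on a filtration only through its test functions and the
  underlying space, and domination preserves both.\<close>

lemma invariant_measures_Q: "invariant_measures (quot_filtration \<beta> E2 E3) = invariant_measures E3"
proof -
  have "test_functions E3 = test_functions (quot_filtration \<beta> E2 E3)"
    using dominates(2) by (rule dominates_test_functions) unfold_locales
  then show ?thesis
    by (simp add: invariant_measures_def distributions_def) (simp add: quot_filtration_def)
qed

lemma \<mu>1_F1:
  assumes "(i, j) \<in> Ord E2"
  shows "\<mu>1 (indicator (F1 j)) = of_nat (card (quot (F1 j) (F1 i))) * \<mu>1 (indicator (F1 i))"
proof -
  obtain k l where "(k, l) \<in> Ord E1" "Fil E1 k = F1 i" "Fil E1 l = F1 j"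
    using assms by (rule F1_filtration)
  then show ?thesis using E1.measure_Fil[OF \<mu>1(1)] by metis
qed

lemma \<mu>1_F1_nonzero: "i \<in> Idx E2 \<Longrightarrow> \<mu>1 (indicator (F1 i)) \<noteq> 0"
  using F1_Fil E1.measure_nonzero[OF \<mu>1] by metis

lemma F3_measure_unique:
  assumes "\<mu> \<in> invariant_measures E3" "\<nu> \<in> invariant_measures E3"
    and "\<And>i. i \<in> Idx E2 \<Longrightarrow> \<mu> (indicator (F3 i)) = \<nu> (indicator (F3 i))"
  shows "\<mu> = \<nu>"
  using assms Q.measure_unique[unfolded invariant_measures_Q, of \<mu> \<nu>] by (simp add: quot_filtration_def)

text \<open>Replaces the definite description by its defining equations. The products have the right
  index relation because \<open>card_quot\<close> makes indices multiplicative along the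
  triple.\<close>

lemma measure_tensor:
  assumes \<mu>3: "\<mu>3 \<in> invariant_measures E3"
  shows "measure_tensor \<alpha> \<beta> E1 E2 \<mu>1 \<mu>3 = \<mu>2 \<longleftrightarrow>
    (\<forall>j\<in>Idx E2. \<mu>2 (indicator (Fil E2 j)) = \<mu>1 (indicator (F1 j)) * \<mu>3 (indicator (F3 j)))"
proof -
  have "\<exists>\<mu>\<in>invariant_measures E2. \<forall>j\<in>Idx E2.
      \<mu> (indicator (Fil E2 j)) = \<mu>1 (indicator (F1 j)) * \<mu>3 (indicator (F3 j))"
  proof (rule E2.measure_exists)
    fix i j assume ij: "(i, j) \<in> Ord E2"
    obtain k l where "(k, l) \<in> Ord E3" "Fil E3 k = F3 i" "Fil E3 l = F3 j"
      using ij by (rule F3_filtration)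
    then have "\<mu>3 (indicator (F3 j)) = of_nat (card (quot (F3 j) (F3 i))) * \<mu>3 (indicator (F3 i))"
      using E3.measure_Fil[OF \<mu>3] by metis
    then show "\<mu>1 (indicator (F1 j)) * \<mu>3 (indicator (F3 j)) =
        of_nat (card (quot (Fil E2 j) (Fil E2 i))) * (\<mu>1 (indicator (F1 i)) * \<mu>3 (indicator (F3 i)))"
      by (simp add: \<mu>1_F1[OF ij] card_quot[OF ij] mult_ac)
  qed
  then have ex1: "\<exists>!\<mu>. \<mu> \<in> invariant_measures E2 \<and> (\<forall>j\<in>Idx E2.
      \<mu> (indicator (Fil E2 j)) = \<mu>1 (indicator (F1 j)) * \<mu>3 (indicator (F3 j)))"
    by (auto intro: E2.measure_unique)
  show ?thesis
  proof
    assume "measure_tensor \<alpha> \<beta> E1 E2 \<mu>1 \<mu>3 = \<mu>2"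
    then show "\<forall>j\<in>Idx E2.
        \<mu>2 (indicator (Fil E2 j)) = \<mu>1 (indicator (F1 j)) * \<mu>3 (indicator (F3 j))"
      using theI'[OF ex1] unfolding measure_tensor_def by simp
  next
    assume "\<forall>j\<in>Idx E2. \<mu>2 (indicator (Fil E2 j)) = \<mu>1 (indicator (F1 j)) * \<mu>3 (indicator (F3 j))"
    then show "measure_tensor \<alpha> \<beta> E1 E2 \<mu>1 \<mu>3 = \<mu>2"
      using the1_equality[OF ex1, of \<mu>2] \<mu>2(1) unfolding measure_tensor_def by blast
  qed
qed

text \<open>The defining equations are solved by division, as \<open>\<mu>1\<close> does not vanish
  on any \<open>F1 j\<close>.\<close>

lemma measure_quotient:
  obtains \<mu>3 where "\<mu>3 \<in> invariant_measures E3" "\<mu>3 \<noteq> 0"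
    "measure_tensor_inverse \<alpha> \<beta> E1 E2 E3 \<mu>1 \<mu>2 = measure_inverse E3 \<mu>3"
    "\<forall>j\<in>Idx E2. \<mu>2 (indicator (Fil E2 j)) = \<mu>1 (indicator (F1 j)) * \<mu>3 (indicator (F3 j))"
proof -
  have "\<exists>\<mu>\<in>invariant_measures (quot_filtration \<beta> E2 E3). \<forall>j\<in>Idx (quot_filtration \<beta> E2 E3).
      \<mu> (indicator (Fil (quot_filtration \<beta> E2 E3) j)) =
      \<mu>2 (indicator (Fil E2 j)) / \<mu>1 (indicator (F1 j))"
  proof (rule Q.measure_exists)
    fix i j assume "(i, j) \<in> Ord (quot_filtration \<beta> E2 E3)"
    then have ij: "(i, j) \<in> Ord E2" by (simp add: quot_filtration_def)
    then have ne: "\<mu>1 (indicator (F1 i)) \<noteq> 0" "\<mu>1 (indicator (F1 j)) \<noteq> 0"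
      using \<mu>1_F1_nonzero E2.Ord_Idx by blast+
    then show "\<mu>2 (indicator (Fil E2 j)) / \<mu>1 (indicator (F1 j)) =
        of_nat (card (quot (Fil (quot_filtration \<beta> E2 E3) j) (Fil (quot_filtration \<beta> E2 E3) i))) *
        (\<mu>2 (indicator (Fil E2 i)) / \<mu>1 (indicator (F1 i)))"
      using E2.measure_Fil[OF \<mu>2(1) ij] \<mu>1_F1[OF ij]
      by (simp add: quot_filtration_def card_quot[OF ij] field_simps)
  qed
  then obtain \<mu>3 where \<mu>3: "\<mu>3 \<in> invariant_measures E3"
    and val: "\<And>j. j \<in> Idx E2 \<Longrightarrow> \<mu>3 (indicator (F3 j)) = \<mu>2 (indicator (Fil E2 j)) / \<mu>1 (indicator (F1 j))"
    unfolding invariant_measures_Q by (auto simp: quot_filtration_def)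
  have tensor: "\<mu>2 (indicator (Fil E2 j)) = \<mu>1 (indicator (F1 j)) * \<mu>3 (indicator (F3 j))"
    if "j \<in> Idx E2" for j
    using val[OF that] \<mu>1_F1_nonzero[OF that] by simp
  have "\<mu>3 \<noteq> 0"
  proof
    assume "\<mu>3 = 0"
    moreover obtain j where j: "j \<in> Idx E2" using E2.Idx_nonempty by blast
    ultimately show False using tensor[OF j] E2.measure_nonzero[OF \<mu>2 j] by simp
  qed
  \<comment> \<open>Any other solution has the same values on all \<open>F3 j\<close>, and these
    determine a measure on \<open>E3\<close>.\<close>
  moreover have "(THE \<mu>3. \<mu>3 \<in> invariant_measures E3 \<and> measure_tensor \<alpha> \<beta> E1 E2 \<mu>1 \<mu>3 = \<mu>2) = \<mu>3"
  proof (rule the_equality)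
    show "\<mu>3 \<in> invariant_measures E3 \<and> measure_tensor \<alpha> \<beta> E1 E2 \<mu>1 \<mu>3 = \<mu>2"
      using \<mu>3 tensor by (simp add: measure_tensor)
    fix \<nu> assume \<nu>: "\<nu> \<in> invariant_measures E3 \<and> measure_tensor \<alpha> \<beta> E1 E2 \<mu>1 \<nu> = \<mu>2"
    have "\<nu> (indicator (F3 j)) = \<mu>3 (indicator (F3 j))" if j: "j \<in> Idx E2" for j
    proof -
      have "\<mu>2 (indicator (Fil E2 j)) = \<mu>1 (indicator (F1 j)) * \<nu> (indicator (F3 j))"
        using \<nu> measure_tensor[of \<nu>] j by blast
      then show ?thesis using tensor[OF j] \<mu>1_F1_nonzero[OF j] by simp
    qed
    then show "\<nu> = \<mu>3" using \<nu> \<mu>3 by (intro F3_measure_unique) auto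
  qed
  then have "measure_tensor_inverse \<alpha> \<beta> E1 E2 E3 \<mu>1 \<mu>2 = measure_inverse E3 \<mu>3"
    by (simp add: measure_tensor_inverse_def)
  ultimately show thesis using that \<mu>3 tensor by blast
qed

section \<open>Pullbacks along \<alpha> and \<beta>\<close>

lemma dual_map_functional:
  assumes "u \<in> functionals (Scale E3) (Vec E3)"
  shows "dual_map E2 \<beta> u \<in> functionals (Scale E2) (Vec E2)"
proof -
  have \<beta>V: "\<beta> x \<in> Vec E3" if "x \<in> Vec E2" for x using that \<beta>_image by blast
  have sc: "Scale E2 c x \<in> Vec E2" if x: "x \<in> Vec E2" for c x
  proof -
    obtain i where "i \<in> Idx E2" "x \<in> Fil E2 i" using x by (rule E2.Vec_cases)
    then show ?thesis using E2.Fil_scale E2.Fil_subset_Vec by blast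
  qed
  show ?thesis
    unfolding functionals_def linear_on_def
  proof (intro CollectI conjI ballI allI impI)
    show "dual_map E2 \<beta> u (x + y) = dual_map E2 \<beta> u x + dual_map E2 \<beta> u y"
      if "x \<in> Vec E2" "y \<in> Vec E2" for x y
      using that E2.Vec_add[OF that] functional_add[OF assms \<beta>V \<beta>V, OF that] \<beta>_add[OF that]
      by (simp add: dual_map_def pullback_def)
    show "dual_map E2 \<beta> u (Scale E2 c x) = c * dual_map E2 \<beta> u x" if "x \<in> Vec E2" for c x
      using that sc[OF that] functional_scale[OF assms \<beta>V, OF that] \<beta>_scale[OF that]
      by (simp add: dual_map_def pullback_def)
  qed (simp add: dual_map_def pullback_def)
qed

lemma dual_map_annihilator_iff:
  assumes u: "u \<in> functionals (Scale E3) (Vec E3)" and i: "i \<in> Idx E2" and k: "Fil E3 k = F3 i"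
  shows "dual_map E2 \<beta> u \<in> annihilator E2 i \<longleftrightarrow> u \<in> annihilator E3 k"
  using dual_map_functional[OF u] u E2.Fil_subset_Vec[OF i]
  by (auto simp: annihilator_def k dual_map_def pullback_def subset_iff)

lemma pullback_test: "f \<in> test_functions E2 \<Longrightarrow> pullback (Vec E1) \<alpha> f \<in> test_functions E1"
proof -
  assume "f \<in> test_functions E2"
  then obtain i j where f: "adapted E2 i j f" by (auto simp: test_functions_iff)
  obtain k l where kl: "(k, l) \<in> Ord E1" "Fil E1 k = F1 i" "Fil E1 l = F1 j"
    using E2.adapted_Ord[OF f] by (elim F1_filtration)
  have "adapted E1 k l (pullback (Vec E1) \<alpha> f)"
    using f kl \<alpha>_mem \<alpha>_add E1.Vec_add unfolding adapted_def by (auto simp: pullback_def)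
  then show ?thesis by (rule test_functionsI)
qed

text \<open>If \<beta> agrees at \<open>x\<close> and some \<open>h\<close> in
  \<open>Fil E2 i\<close>, then \<open>x - h\<close> is in the kernel of \<beta>, hence of the form
  \<open>\<alpha> z\<close>, and the preimage of the coset is a translate of \<open>F1 i\<close>.
  Otherwise the coset misses the image of \<alpha>.\<close>

lemma \<mu>1_pullback_coset:
  assumes x: "x \<in> Vec E2" and i: "i \<in> Idx E2"
  shows "\<mu>1 (pullback (Vec E1) \<alpha> (indicator (x +o Fil E2 i))) =
    (if \<beta> x \<in> F3 i then \<mu>1 (indicator (F1 i)) else 0)"
proof (cases "\<beta> x \<in> F3 i")
  case True
  then obtain h where h: "h \<in> Fil E2 i" "\<beta> h = \<beta> x" by auto
  then have hV: "h \<in> Vec E2" using E2.Fil_subset_Vec[OF i] by blast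
  then have "x - h \<in> Vec E2" "\<beta> (x - h) = 0"
    using h x \<beta>_diff add_subgroup_diff[OF E2.Vec_subgroup] by auto
  then obtain z where z: "z \<in> Vec E1" "\<alpha> z = x - h"
  proof -
    have "x - h \<in> \<alpha> ` Vec E1"
      unfolding ker_\<beta> using \<open>x - h \<in> Vec E2\<close> \<open>\<beta> (x - h) = 0\<close> by simp
    then show thesis by (elim imageE) (rule that, simp_all)
  qed
  obtain k where k: "k \<in> Idx E1" "Fil E1 k = F1 i" using F1_Fil[OF i] by blast
  \<comment> \<open>Since \<open>\<alpha> z = x - h\<close>, the elements
    \<open>\<alpha> (y - z)\<close> and \<open>\<alpha> y - x\<close> differ by \<open>h\<close>,
    which lies in the subgroup.\<close>
  have "y \<in> Vec E1 \<and> \<alpha> y - x \<in> Fil E2 i \<longleftrightarrow> y - z \<in> F1 i" for y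
  proof -
    have "y - z \<in> Vec E1 \<longleftrightarrow> y \<in> Vec E1"
      using add_subgroup_add_iff[OF E1.Vec_subgroup z(1), of "y - z"] by simp
    moreover have "\<alpha> (y - z) \<in> Fil E2 i \<longleftrightarrow> \<alpha> y - x \<in> Fil E2 i" if "y \<in> Vec E1"
    proof -
      have "\<alpha> (y - z) = \<alpha> y - x + h" using \<alpha>_diff[OF that z(1)] z(2) by simp
      then show ?thesis using add_subgroup_add_iff[OF E2.Fil_subgroup[OF i] h(1)] by simp
    qed
    ultimately show ?thesis by blast
  qed
  then have "pullback (Vec E1) \<alpha> (indicator (x +o Fil E2 i)) =
      (indicator (z +o Fil E1 k) :: _ \<Rightarrow> complex)"
    unfolding k(2) by (auto simp: pullback_def indicator_def fun_eq_iff simp flip: set_minus_plus)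
  then show ?thesis using True E1.measure_coset[OF \<mu>1(1) z(1) k(1)] k(2) by simp
next
  case False
  have "\<alpha> y - x \<notin> Fil E2 i" if y: "y \<in> Vec E1" for y
  proof
    assume *: "\<alpha> y - x \<in> Fil E2 i"
    have "- (\<alpha> y - x) \<in> Fil E2 i" using add_subgroup_uminus[OF E2.Fil_subgroup[OF i] *] .
    moreover have "\<beta> (- (\<alpha> y - x)) = \<beta> x"
      using \<beta>_diff[OF x \<alpha>_mem[OF y]] \<beta>_\<alpha>[OF y] by simp
    ultimately show False using False by (metis imageI)
  qed
  then have "pullback (Vec E1) \<alpha> (indicator (x +o Fil E2 i)) = (\<lambda>y. 0 :: complex)"
    by (auto simp: pullback_def indicator_def fun_eq_iff simp flip: set_minus_plus)
  then show ?thesis using False E1.measure_zero[OF \<mu>1(1)] by simp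
qed

section \<open>Poisson summation and its form for distributions\<close>

abbreviation "\<nu>3 \<equiv> measure_tensor_inverse \<alpha> \<beta> E1 E2 E3 \<mu>1 \<mu>2"

lemma \<nu>3_invariant: "\<nu>3 \<in> invariant_measures (dual E3)"
  by (rule measure_quotient) (simp add: measure_inverse(1)[OF is_character C1(3)])

text \<open>The normalisation behind (1): the mass of \<open>F3 i\<close> under the quotient measure
  cancels against its reciprocal.\<close>

lemma \<nu>3_annihilator:
  assumes i: "i \<in> Idx E2" and k: "k \<in> Idx E3" "Fil E3 k = F3 i"
  shows "\<mu>2 (indicator (Fil E2 i)) * \<nu>3 (indicator (annihilator E3 k)) = \<mu>1 (indicator (F1 i))"
proof -
  obtain \<mu>3 where \<mu>3: "\<mu>3 \<in> invariant_measures E3" "\<mu>3 \<noteq> 0" "\<nu>3 = measure_inverse E3 \<mu>3"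
    "\<forall>j\<in>Idx E2. \<mu>2 (indicator (Fil E2 j)) = \<mu>1 (indicator (F1 j)) * \<mu>3 (indicator (F3 j))"
    by (rule measure_quotient)
  show ?thesis
    using E3.measure_nonzero[OF \<mu>3(1,2) k(1)] k
    by (simp add: \<mu>3(3) measure_inverse(2)[OF is_character C1(3) \<mu>3(1,2) k(1)] \<mu>3(4)[rule_format, OF i])
qed

lemma poisson:
  assumes "f \<in> test_functions E2"
  defines "R \<equiv> \<lambda>f. pullback (Vec (dual E3)) (dual_map E2 \<beta>) (fourier \<psi> E2 \<mu>2 f)"
  shows "\<mu>1 (pullback (Vec E1) \<alpha> f) = \<nu>3 (R f)"
proof -
  \<comment> \<open>Membership of \<open>R f\<close> is carried through the induction, because
    \<open>\<nu>3\<close> is additive and homogeneous only on test functions.\<close>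
  have "R f \<in> test_functions (dual E3) \<and> \<mu>1 (pullback (Vec E1) \<alpha> f) = \<nu>3 (R f)"
    using assms(1)
  proof (induction rule: E2.test_function_induct)
    case (coset x i)
    obtain k where k: "k \<in> Idx E3" "Fil E3 k = F3 i" using F3_Fil[OF coset(2)] by blast
    have \<beta>x: "\<beta> x \<in> Vec E3" using coset(1) \<beta>_image by blast
    \<comment> \<open>The exponent \<open>u (\<beta> x)\<close> is written through
      \<open>bidual_map\<close>, so that \<beta>\<open>x\<close> acts as a frequency for the dual
      and \<open>measure_Fil_character\<close> applies there.\<close>
    have R: "R (indicator (x +o Fil E2 i)) = (\<lambda>u. \<mu>2 (indicator (Fil E2 i)) *
        (indicator (annihilator E3 k) u * cnj (\<psi> (bidual_map E3 (\<beta> x) u))))"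
    proof
      fix u show "R (indicator (x +o Fil E2 i)) u = \<mu>2 (indicator (Fil E2 i)) *
        (indicator (annihilator E3 k) u * cnj (\<psi> (bidual_map E3 (\<beta> x) u)))"
      proof (cases "u \<in> Vec (dual E3)")
        case True
        have "(indicator (annihilator E2 i) (dual_map E2 \<beta> u) :: complex) = indicator (annihilator E3 k) u"
          using dual_map_annihilator_iff[OF Vec_dual_functional[OF True] coset(2) k(2)]
          by (simp add: indicator_def)
        then show ?thesis
          unfolding R_def E2.fourier_coset[OF is_character \<mu>2(1) coset] using True coset(1)
          by (simp add: pullback_def dual_map_def bidual_map_def)
      next
        case False
        then have "u \<notin> annihilator E3 k" using annihilator_subset_dual[OF k(1)] by blast
        with False show ?thesis by (simp add: R_def pullback_def)
      qed
    qed
    have k': "k \<in> Idx (dual E3)" using k(1) by simp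
    note char3 = dual3.measure_Fil_character[OF is_character \<nu>3_invariant k' bidual_map_mem[OF is_character C1(3) \<beta>x]]
    have "\<nu>3 (R (indicator (x +o Fil E2 i))) = \<mu>2 (indicator (Fil E2 i)) *
        (indicator (annihilator (dual E3) k) (bidual_map E3 (\<beta> x)) * \<nu>3 (indicator (annihilator E3 k)))"
      unfolding R using dual3.measure_scale[OF \<nu>3_invariant char3(1)] char3(2) by simp
    also have "\<dots> = (if \<beta> x \<in> F3 i then \<mu>1 (indicator (F1 i)) else 0)"
      using bidual_map_annihilator_iff[OF is_character C1(3) k(1) \<beta>x] \<nu>3_annihilator[OF coset(2) k] k(2)
      by (simp add: indicator_def)
    also have "\<dots> = \<mu>1 (pullback (Vec E1) \<alpha> (indicator (x +o Fil E2 i)))"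
      by (rule \<mu>1_pullback_coset[OF coset, symmetric])
    finally have "\<mu>1 (pullback (Vec E1) \<alpha> (indicator (x +o Fil E2 i))) = \<nu>3 (R (indicator (x +o Fil E2 i)))"
      by (rule sym)
    moreover have "R (indicator (x +o Fil E2 i)) \<in> test_functions (dual E3)"
      unfolding R using dual3.test_scale[OF char3(1)] by simp
    ultimately show ?case by blast
  next
    case (scale f c)
    have "R (\<lambda>x. c * f x) = (\<lambda>u. c * R f u)"
      unfolding R_def E2.fourier_scale[OF is_character \<mu>2(1) scale(1)] by (auto simp: pullback_def)
    moreover have "pullback (Vec E1) \<alpha> (\<lambda>x. c * f x) = (\<lambda>x. c * pullback (Vec E1) \<alpha> f x)"
      by (auto simp: pullback_def)
    ultimately show ?case
      using scale dual3.test_scale dual3.measure_scale[OF \<nu>3_invariant]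
        E1.measure_scale[OF \<mu>1(1) pullback_test[OF scale(1)]] by simp
  next
    case (add f g)
    have "R (\<lambda>x. f x + g x) = (\<lambda>u. R f u + R g u)"
      unfolding R_def E2.fourier_add[OF is_character \<mu>2(1) add(1,2)] by (auto simp: pullback_def)
    moreover have "pullback (Vec E1) \<alpha> (\<lambda>x. f x + g x) =
        (\<lambda>x. pullback (Vec E1) \<alpha> f x + pullback (Vec E1) \<alpha> g x)"
      by (auto simp: pullback_def)
    ultimately show ?case
      using add dual3.test_add dual3.measure_add[OF \<nu>3_invariant]
        E1.measure_add[OF \<mu>1(1) pullback_test[OF add(1)] pullback_test[OF add(2)]] by simp
  qed
  then show ?thesis by blast
qed

text \<open>Apply \<open>poisson\<close> to the transform of \<open>g\<close>, whose transform is \<open>g\<close> composed with negation.\<close>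

lemma fourier_char_distribution:
  "fourier_dist \<psi> E2 (measure_inverse E2 \<mu>2) (char_distribution \<alpha> E1 E2 \<mu>1) =
    char_distribution (dual_map E2 \<beta>) (dual E3) (dual E2) \<nu>3"
proof
  fix g
  show "fourier_dist \<psi> E2 (measure_inverse E2 \<mu>2) (char_distribution \<alpha> E1 E2 \<mu>1) g =
      char_distribution (dual_map E2 \<beta>) (dual E3) (dual E2) \<nu>3 g"
  proof (cases "g \<in> test_functions (dual E2)")
    case True
    define f where "f = pullback (Vec E2) (bidual_map E2) (fourier \<psi> (dual E2) (measure_inverse E2 \<mu>2) g)"
    have f: "f \<in> test_functions E2" "fourier \<psi> E2 \<mu>2 f = (\<lambda>w. g (- w))"
      unfolding f_def by (rule fourier_inversion[OF is_character C1(2) \<mu>2 True])+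
    have neg: "- u \<in> Vec (dual E3) \<longleftrightarrow> u \<in> Vec (dual E3)" for u
      by (rule add_subgroup_uminus_iff[OF dual3.Vec_subgroup])
    have "\<mu>1 (pullback (Vec E1) \<alpha> f) = \<nu>3 (pullback (Vec (dual E3)) (dual_map E2 \<beta>) (\<lambda>w. g (- w)))"
      using poisson[OF f(1)] f(2) by simp
    also have "pullback (Vec (dual E3)) (dual_map E2 \<beta>) (\<lambda>w. g (- w)) =
        (\<lambda>u. pullback (Vec (dual E3)) (dual_map E2 \<beta>) g (- u))"
    proof
      fix u
      \<comment> \<open>The dual map is compatible with negation, so the reflection on the dual of
        \<open>E2\<close> becomes a reflection on the dual of \<open>E3\<close>, where
        \<open>\<nu>3\<close> is even.\<close>
      have "- dual_map E2 \<beta> u = dual_map E2 \<beta> (- u)"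
        by (auto simp: dual_map_def pullback_def fun_eq_iff)
      then show "pullback (Vec (dual E3)) (dual_map E2 \<beta>) (\<lambda>w. g (- w)) u =
          pullback (Vec (dual E3)) (dual_map E2 \<beta>) g (- u)"
        by (simp add: pullback_def neg)
    qed
    also have "\<nu>3 \<dots> = \<nu>3 (pullback (Vec (dual E3)) (dual_map E2 \<beta>) g)"
      by (rule dual3.measure_uminus[OF \<nu>3_invariant])
    finally show ?thesis
      using True f(1) by (simp add: fourier_dist_def char_distribution_def f_def)
  qed (simp add: fourier_dist_def char_distribution_def)
qed

end

theorem theorem1:
  fixes \<psi> :: "'k::{field, finite} \<Rightarrow> complex"
    and E1 :: "('k, 'v1::ab_group_add, 'i1) filtered"
    and E2 :: "('k, 'v2::ab_group_add, 'i2) filtered"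
    and E3 :: "('k, 'v3::ab_group_add, 'i3) filtered"
    and \<alpha> :: "'v1 \<Rightarrow> 'v2" and \<beta> :: "'v2 \<Rightarrow> 'v3"
    and \<mu>1 :: "('v1 \<Rightarrow> complex) \<Rightarrow> complex" and \<mu>2 :: "('v2 \<Rightarrow> complex) \<Rightarrow> complex"
  assumes "nontrivial_character \<psi>"
    and "admissible_triple \<alpha> \<beta> E1 E2 E3"
    and "complete_filtered E1" and "complete_filtered E2" and "complete_filtered E3"
    and "\<mu>1 \<in> invariant_measures E1" and "\<mu>1 \<noteq> 0"
    and "\<mu>2 \<in> invariant_measures E2" and "\<mu>2 \<noteq> 0"
  shows "(\<forall>f\<in>test_functions E2.
            \<mu>1 (pullback (Vec E1) \<alpha> f) =
            measure_tensor_inverse \<alpha> \<beta> E1 E2 E3 \<mu>1 \<mu>2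
              (pullback (Vec (dual E3)) (dual_map E2 \<beta>) (fourier \<psi> E2 \<mu>2 f))) \<and>
         fourier_dist \<psi> E2 (measure_inverse E2 \<mu>2) (char_distribution \<alpha> E1 E2 \<mu>1) =
         char_distribution (dual_map E2 \<beta>) (dual E3) (dual E2)
           (measure_tensor_inverse \<alpha> \<beta> E1 E2 E3 \<mu>1 \<mu>2)"
proof -
  interpret admissible \<psi> \<alpha> \<beta> E1 E2 E3 \<mu>1 \<mu>2
    using assms by unfold_locales
  show ?thesis using poisson fourier_char_distribution by blast
qed

end
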